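(* Let $n\ge1$. If $\pi\in S_n$ has exactly $k$ descents and $m$ is a nonnegative integer, then the number of permutations $\sigma\in S_n$ which have exactly $m$ descents and satisfy $s(\sigma)=\pi$ is given by \[\sum_{\substack{\mathscr H\in\mathcal H_{\{0,2\}}(\pi)\\ j_0+j_1+\cdots+j_k=m-k}}\ \prod_{t=0}^kN(\widehat q_t(\mathscr H),j_t+1),\] where the numbers $j_0,j_1,\ldots,j_k$ in the sum are nonnegative integers that sum to $m-k$, $s$ is the deterministic stack-sorting map, and $N(a,b)=\frac1a\binom ab\binom a{b-1}$ is the Narayana number.
   Context: Notation: $[m]=\{1,\ldots,m\}$; permutations in $S_n$ are written as words $\pi_1\cdots\pi_n$. A descent of $\pi$ is an index $i\in[n-1]$ with $\pi_i>\pi_{i+1}$. Stack-sorting map. Given an input permutation $\sigma=\sigma_1\cdots\sigma_n$, $s(\sigma)$ is computed using a vertical stack (initially empty): at any time, if the leftmost remaining entry of the input is smaller than the entry at the top of the stack, or if the stack is empty, that leftmost entry is placed on top of the stack; otherwise the entry at the top of the stack is removed and annexed to the right end of the growing output. (Once the input is exhausted, the stack is emptied into the output from the top.) The final output is $s(\sigma)$. For example, $s(35214)=31245$. Valid hook configurations. The diagram of $\pi$ consists of the points $(i,\pi_i)$, $i\in[n]$. A hook $H$ is determined by indices $i<j$ with $\pi_i<\pi_j$: it is the union of the vertical segment from $(i,\pi_i)$ to $(i,\pi_j)$ and the horizontal segment from $(i,\pi_j)$ to $(j,\pi_j)$. Its southwest endpoint is ${}_eH=(i,\pi_i)$ and its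 northeast endpoint is $H^e=(j,\pi_j)$. A valid hook configuration of $\pi$ is a $M$-tuple $\mathscr H=(H_1,\ldots,H_M)$ ($M\ge 0$) of hooks in the diagram of $\pi$ such that: (a) if ${}_eH_\ell=(i_\ell,\pi_{i_\ell})$ for each $\ell\in[M]$, then $i_1<i_2<\cdots<i_M$; (b) if $i$ is a descent of $\pi$, then $(i,\pi_i)={}_eH_\ell$ for some $\ell\in[M]$; (c) if $(j,\pi_j)=H_\ell^e$ for some $\ell\in[M]$, then there exist $\ell',\ell''\in[M]$ such that the $x$-coordinate of ${}_eH_{\ell'}$ is a descent of $\pi$, $(j-1,\pi_{j-1})={}_eH_{\ell''}$, and $H_{\ell'}^e=H_{\ell''}^e=(j,\pi_j)$; (d) if $\ell,\ell'\in[M]$, ${}_eH_\ell=(i,\pi_i)$, $H_\ell^e=(j,\pi_j)$, ${}_eH_{\ell'}=(i',\pi_{i'})$, $H_{\ell'}^e=(j',\pi_{j'})$, $\pi_j<\pi_{j'}$, and the real intervals $[i,j]$ and $[i',j']$ have more than one point in common, then $[i,j]\subseteq[i',j']$. The identity permutation has exactly one valid hook configuration, the empty one. Write $\mathcal H(\pi)$ for the set of valid hook configurations of $\pi$, $|\mathscr H|=M$ for the number of hooks, and $NE(\mathscr H)=\{H_1^e,\ldots,H_M^e\}$. For $j\in[n]$, $w_j(\mathscr H)$ is the number of hooks in $\mathscr H$ with northeast endpoint $(j,\pi_j)$. $\mathcal H_{\{0,2\}}(\pi)=\{\mathscr H\in\mathcal H(\pi): w_j(\mathscr H)\in\{0,2\}\text{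 for all }j\in[n]\}$. Coloring. Given $\mathscr H=(H_1,\ldots,H_M)\in\mathcal H(\pi)$, color the points of the diagram with colors $c_0,\ldots,c_M$. The hook $H_\ell$ has color $c_\ell$; if ${}_eH_\ell=(i,\pi_i)$ and $H_\ell^e=(j,\pi_j)$, its top part is the segment from $(i+1/2,\pi_j)$ to $(j,\pi_j)$. If $(k,\pi_k)\in NE(\mathscr H)$, give $(k,\pi_k)$ the color $c_r$ where $r$ is the largest index with $H_r^e=(k,\pi_k)$. Otherwise move directly upward from $(k,\pi_k)$ until first hitting the top part of a hook, and give $(k,\pi_k)$ the color of that hook; if several hooks are hit simultaneously, use the one whose southwest endpoint is farthest to the right; if no top part is hit, use $c_0$. Let $q_t(\mathscr H)$ be the number of points $(\ell,\pi_\ell)$ of color $c_t$. Reduced color counts. Let $\Theta(\mathscr H)$ be the set of $i\in\{0,1,\ldots,|\mathscr H|\}$ such that $c_i$ is not the color of any point in $NE(\mathscr H)$, and $\widehat{|\mathscr H|}=|\Theta(\mathscr H)|-1=|\mathscr H|-|NE(\mathscr H)|$. Writing $\Theta(\mathscr H)=\{i_0<i_1<\cdots<i_{\widehat{|\mathscr H|}}\}$, set $\widehat q_t(\mathscr H)=q_{i_t}(\mathscr H)$. For $\mathscr H\in\mathcal H_{\{0,2\}}(\pi)$ with $\pi$ having $k$ descents, $\widehat{|\mathscr H|}=k$. *)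

theory Defs
  imports Complex_Main "HOL-Combinatorics.Multiset_Permutations"
begin

text \<open>
  A permutation in $S_n$ is its word, an element of \<^term>\<open>permutations_of_set {1..n}\<close>.
  Positions and hook indices are numbered from 1, as on paper.
\<close>

definition entry :: "nat list \<Rightarrow> nat \<Rightarrow> nat" where
  "entry \<pi> i = \<pi> ! (i - 1)"

definition descents :: "nat list \<Rightarrow> nat set" where
  "descents \<pi> = {i. 1 \<le> i \<and> i < length \<pi> \<and> entry \<pi> i > entry \<pi> (i + 1)}"

text \<open>
  The first argument is the remaining input, the second the stack (top first);
  the result is the output still to be produced.
\<close>

fun stack_run :: "nat list \<Rightarrow> nat list \<Rightarrow> nat list" where
  "stack_run [] st = st"
| "stack_run (x # xs) [] = stack_run xs [x]"
| "stack_run (x # xs) (t # st) =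
     (if x < t then stack_run xs (x # t # st) else t # stack_run (x # xs) st)"

definition stack_sort :: "nat list \<Rightarrow> nat list" where
  "stack_sort \<sigma> = stack_run \<sigma> []"

text \<open>
  A hook is encoded by the pair $(i,j)$ of the $x$-coordinates of its southwest and northeast
  endpoints. A point of the diagram is likewise encoded by its $x$-coordinate, so that
  \<open>sw hs l\<close> and \<open>ne hs l\<close> stand for ${}_eH_l$ and $H_l^e$, and \<open>NE hs\<close> for the set of
  northeast endpoints.
\<close>

definition is_hook :: "nat list \<Rightarrow> nat \<times> nat \<Rightarrow> bool" where
  "is_hook \<pi> h \<longleftrightarrow> 1 \<le> fst h \<and> fst h < snd h \<and> snd h \<le> length \<pi> \<and>
     entry \<pi> (fst h) < entry \<pi> (snd h)"

definition sw :: "(nat \<times> nat) list \<Rightarrow> nat \<Rightarrow> nat" where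
  "sw hs l = fst (hs ! (l - 1))"

definition ne :: "(nat \<times> nat) list \<Rightarrow> nat \<Rightarrow> nat" where
  "ne hs l = snd (hs ! (l - 1))"

definition NE :: "(nat \<times> nat) list \<Rightarrow> nat set" where
  "NE hs = ne hs ` {1..length hs}"

definition hook_interval :: "(nat \<times> nat) list \<Rightarrow> nat \<Rightarrow> real set" where
  "hook_interval hs l = {real (sw hs l)..real (ne hs l)}"

definition valid_hook_configs :: "nat list \<Rightarrow> (nat \<times> nat) list set" where
  "valid_hook_configs \<pi> = {hs.
     (\<forall>h \<in> set hs. is_hook \<pi> h) \<and>
     strict_mono_on {1..length hs} (sw hs) \<and>
     (\<forall>i \<in> descents \<pi>. \<exists>l \<in> {1..length hs}. sw hs l = i) \<and>
     (\<forall>l \<in> {1..length hs}. \<exists>l' \<in> {1..length hs}. \<exists>l'' \<in> {1..length hs}.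
        sw hs l' \<in> descents \<pi> \<and> sw hs l'' = ne hs l - 1 \<and>
        ne hs l' = ne hs l \<and> ne hs l'' = ne hs l) \<and>
     (\<forall>l \<in> {1..length hs}. \<forall>l' \<in> {1..length hs}.
        entry \<pi> (ne hs l) < entry \<pi> (ne hs l') \<longrightarrow>
        (\<exists>x y. x \<noteq> y \<and> {x, y} \<subseteq> hook_interval hs l \<inter> hook_interval hs l') \<longrightarrow>
        hook_interval hs l \<subseteq> hook_interval hs l')}"

definition ne_count :: "(nat \<times> nat) list \<Rightarrow> nat \<Rightarrow> nat" where
  "ne_count hs j = card {l \<in> {1..length hs}. ne hs l = j}"

definition valid_hook_configs_02 :: "nat list \<Rightarrow> (nat \<times> nat) list set" where
  "valid_hook_configs_02 \<pi> =
     {hs \<in> valid_hook_configs \<pi>. \<forall>j \<in> {1..length \<pi>}. ne_count hs j \<in> {0, 2}}"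

definition top_part :: "nat list \<Rightarrow> (nat \<times> nat) list \<Rightarrow> nat \<Rightarrow> (real \<times> real) set" where
  "top_part \<pi> hs l = {real (sw hs l) + 1/2..real (ne hs l)} \<times> {real (entry \<pi> (ne hs l))}"

text \<open>Heights at which the upward ray from the point $(k,\pi_k)$ meets the top part of a hook.\<close>

definition hit_heights :: "nat list \<Rightarrow> (nat \<times> nat) list \<Rightarrow> nat \<Rightarrow> real set" where
  "hit_heights \<pi> hs k =
     {y. real (entry \<pi> k) \<le> y \<and> (\<exists>l \<in> {1..length hs}. (real k, y) \<in> top_part \<pi> hs l)}"

text \<open>The color $c_t$ is encoded by its index $t$.\<close>

definition color :: "nat list \<Rightarrow> (nat \<times> nat) list \<Rightarrow> nat \<Rightarrow> nat" where
  "color \<pi> hs k =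
     (if k \<in> NE hs then Max {r \<in> {1..length hs}. ne hs r = k}
      else if hit_heights \<pi> hs k = {} then 0
      else ARG_MAX (sw hs) l.
             l \<in> {1..length hs} \<and> (real k, Min (hit_heights \<pi> hs k)) \<in> top_part \<pi> hs l)"

definition color_count :: "nat list \<Rightarrow> (nat \<times> nat) list \<Rightarrow> nat \<Rightarrow> nat" where
  "color_count \<pi> hs t = card {i \<in> {1..length \<pi>}. color \<pi> hs i = t}"

definition Theta :: "nat list \<Rightarrow> (nat \<times> nat) list \<Rightarrow> nat set" where
  "Theta \<pi> hs = {i \<in> {0..length hs}. \<forall>p \<in> NE hs. color \<pi> hs p \<noteq> i}"

definition reduced_color_count :: "nat list \<Rightarrow> (nat \<times> nat) list \<Rightarrow> nat \<Rightarrow> nat" where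
  "reduced_color_count \<pi> hs t = color_count \<pi> hs (sorted_list_of_set (Theta \<pi> hs) ! t)"

definition narayana :: "nat \<Rightarrow> nat \<Rightarrow> real" where
  "narayana a b = 1 / real a * real (a choose b) * real (a choose (b - 1))"

end

theory Submission
  imports Defs "HOL-Library.FuncSet" "HOL-Computational_Algebra.Formal_Laurent_Series"
begin

text \<open>
  Let $F_\pi$ be the generating polynomial, by number of descents, of the preimages of $\pi$ under
  the stack-sorting map. Splitting a preimage at its maximum gives
  $F_{\tau n} = \sum_{\tau = AB} F_A F_B x^{[B \neq \emptyset]}$. For increasing words this recursion
  is solved by the Narayana polynomials (Lagrange inversion). If $\pi$ has a descent, let $d$ be the
  descent with the largest entry. The entries exceeding $\pi_d$ form an increasing final segment of
  $\pi$, and induction on the length of that segment yields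
  $F_\pi = x \sum_t F_{U_t} F_{S_t}$, where $t$ runs through the positions in that segment and
  $U_t$, $S_t$ are the subwords of $\pi$ on the positions outside $(d, t]$ and inside $(d, t)$.

  A valid hook configuration in which all weights are $0$ or $2$ is determined by the northeast
  endpoints $h(d)$ of the hooks starting at descents, and the only constraints on $h$ are that
  $(d, h(d))$ is a hook and that the intervals $[d, h(d)]$ are laminar. These maps $h$ decompose
  along the choice of $t = h(d)$ exactly as $F_\pi$ does, and so do the color counts: the points of
  $S_t$ that are uncolored in $S_t$ receive the color of the hook at $d$.
\<close>

section \<open>Fertility polynomials\<close>

text \<open>The recursion at the maximum cuts \<pi> into a prefix and a suffix, whereas the
  decomposition removes an interval of positions. The two meet because of a vanishing: a
  stack-sorted word ends with its largest entry, so a prefix that stops among the smaller entries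
  between the descent and the increasing final segment has no preimages. Of the cuts in that stretch
  only the one directly behind the descent survives, and it supplies the summand of the newly
  appended maximum; the cuts further left or right are governed by the induction hypothesis. The
  descent with the largest entry is chosen because removing an interval behind it then creates no
  new descents: U_t keeps the descents before d, S_t those after d, and the factor x stands for d
  itself. Working with power series postpones the sum over j_0, ..., j_k to a single coefficient
  extraction, where x^k turns m into m - k.\<close>

lemma stack_run_append_stack:
  assumes "\<forall>x \<in> set xs. \<forall>y \<in> set b. x < y"
  shows "stack_run xs (a @ b) = stack_run xs a @ b"
  using assms
proof (induction xs a rule: stack_run.induct)
  case (2 x xs)
  then show ?case by (cases b) auto
qed auto

text \<open>When \<open>n\<close> arrives, it exceeds everything on the stack and flushes it,
  exactly as the end of the input \<open>xs\<close> would; afterwards \<open>n\<close> is alone on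
  the stack.\<close>

lemma stack_run_max:
  assumes "\<forall>x \<in> set xs \<union> set a. x < n"
  shows "stack_run (xs @ n # ys) a = stack_run xs a @ stack_run ys [n]"
  using assms
proof (induction xs a rule: stack_run.induct)
  case (1 st)
  then show ?case by (induction st) auto
qed auto

lemma stack_sort_split:
  assumes "\<forall>x \<in> set xs \<union> set ys. x < n"
  shows "stack_sort (xs @ n # ys) = stack_sort xs @ stack_sort ys @ [n]"
  using assms stack_run_max[of xs "[]" n ys] stack_run_append_stack[of ys "[n]" "[]"]
  by (simp add: stack_sort_def)

lemma mset_stack_run: "mset (stack_run xs st) = mset xs + mset st"
  by (induction xs st rule: stack_run.induct) auto

lemma mset_stack_sort [simp]: "mset (stack_sort xs) = mset xs"
  by (simp add: stack_sort_def mset_stack_run)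

lemma set_stack_sort [simp]: "set (stack_sort xs) = set xs"
  by (metis mset_stack_sort set_mset_mset)

lemma distinct_stack_sort [simp]: "distinct (stack_sort xs) = distinct xs"
  by (metis mset_stack_sort distinct_count_atmost_1 set_mset_mset)

lemma length_stack_sort [simp]: "length (stack_sort xs) = length xs"
  by (metis mset_stack_sort size_mset)

lemma distinct_split_at_max:
  fixes xs :: "nat list"
  assumes "distinct xs" "xs \<noteq> []"
  obtains l n r where "xs = l @ n # r" "\<forall>x \<in> set l \<union> set r. x < n"
proof -
  have "Max (set xs) \<in> set xs" using assms by simp
  then obtain l r where *: "xs = l @ Max (set xs) # r" by (meson split_list)
  have "x < Max (set xs)" if "x \<in> set l \<union> set r" for x
  proof -
    have "x \<in> set xs" using that by (subst *) auto
    hence "x \<le> Max (set xs)" by simp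
    moreover have "x \<noteq> Max (set xs)" using assms(1) that by (subst (asm) *) auto
    ultimately show ?thesis by simp
  qed
  with * that show thesis by blast
qed

lemma last_stack_sort:
  assumes "distinct xs" "x \<in> set xs"
  shows "x \<le> last (stack_sort xs)"
proof -
  have "xs \<noteq> []" using assms by auto
  then obtain l n r where "xs = l @ n # r" "\<forall>x \<in> set l \<union> set r. x < n"
    using assms distinct_split_at_max by metis
  with assms show ?thesis by (auto simp: stack_sort_split intro: less_imp_le)
qed

section \<open>Descents of a word cut at its maximum\<close>

lemma entry_append:
  "1 \<le> i \<Longrightarrow> i \<le> length xs \<Longrightarrow> entry (xs @ ys) i = entry xs i"
  "length xs < i \<Longrightarrow> entry (xs @ ys) i = entry ys (i - length xs)"
  by (auto simp: entry_def nth_append Suc_diff_Suc diff_diff_eq intro!: arg_cong[of _ _ "(!) ys"])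

lemma finite_descents [simp]: "finite (descents xs)"
  by (rule finite_subset[of _ "{..length xs}"]) (auto simp: descents_def)

lemma descents_append_max:
  assumes "\<forall>x \<in> set xs \<union> set ys. x < n"
  shows "descents (xs @ n # ys) =
    descents xs \<union> (if ys = [] then {} else insert (Suc (length xs)) ((\<lambda>i. i + Suc (length xs)) ` descents ys))"
    (is "?l = ?r")
proof (rule set_eqI)
  fix i
  let ?w = "xs @ n # ys" and ?k = "Suc (length xs)"
  have left: "entry ?w j = entry xs j" if "1 \<le> j" "j \<le> length xs" for j
    using that by (simp add: entry_append)
  have mid: "entry ?w ?k = n" by (simp add: entry_append entry_def)
  have right: "entry ?w (j + ?k) = entry ys j" if "1 \<le> j" for j
    using that by (cases j) (auto simp: entry_def nth_append)
  have bl: "entry xs j < n" if "1 \<le> j" "j \<le> length xs" for j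
    using that assms by (auto simp: entry_def)
  have br: "entry ys j < n" if "1 \<le> j" "j \<le> length ys" for j
    using that assms by (auto simp: entry_def)
  consider "i = 0" | "1 \<le> i" "i < length xs" | "1 \<le> i" "i = length xs" | "i = ?k" | "i > ?k" by linarith
  then show "i \<in> ?l \<longleftrightarrow> i \<in> ?r"
  proof cases
    case 1
    then show ?thesis by (auto simp: descents_def)
  next
    case 2
    then show ?thesis by (auto simp: descents_def left)
  next
    case 3
    then show ?thesis using left[of i] bl[of i] mid by (auto simp: descents_def)
  next
    case 4
    then show ?thesis using right[of 1] br[of 1] mid by (cases ys) (auto simp: descents_def)
  next
    case 5
    then obtain j where j: "i = j + ?k" "1 \<le> j" by (metis add.commute less_imp_add_positive Suc_leI One_nat_def)
    have "entry ?w (i + 1) = entry ys (j + 1)" using right[of "j+1"] j by (simp add: add.commute add.left_commute)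
    with j right[of j] show ?thesis by (auto simp: descents_def)
  qed
qed

lemma card_descents_append_max:
  assumes "\<forall>x \<in> set xs \<union> set ys. x < n"
  shows "card (descents (xs @ n # ys)) = card (descents xs) + (if ys = [] then 0 else Suc (card (descents ys)))"
proof -
  let ?k = "Suc (length xs)"
  let ?R = "insert ?k ((\<lambda>i. i + ?k) ` descents ys)"
  have "?k \<notin> (\<lambda>i. i + ?k) ` descents ys" by (auto simp: descents_def)
  moreover have "inj_on (\<lambda>i. i + ?k) (descents ys)" by (auto simp: inj_on_def)
  ultimately have "card ?R = Suc (card (descents ys))" by (subst card_insert_disjoint) (auto simp: card_image)
  moreover have "descents xs \<inter> ?R = {}" by (auto simp: descents_def)
  hence "card (descents xs \<union> ?R) = card (descents xs) + card ?R" by (intro card_Un_disjoint) auto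
  ultimately show ?thesis using assms by (simp add: descents_append_max)
qed

lemma descents_Nil [simp]: "descents [] = {}" by (auto simp: descents_def)

definition preimages :: "nat list \<Rightarrow> nat list set" where
  "preimages \<pi> = {\<sigma>. stack_sort \<sigma> = \<pi>}"

text \<open>A polynomial, but typed as a power series: it is compared with
  \<open>narayana_series\<close> and embedded into Laurent series.\<close>

definition fertility :: "nat list \<Rightarrow> real fps" where
  "fertility \<pi> = (\<Sum>\<sigma>\<in>preimages \<pi>. fps_X ^ card (descents \<sigma>))"

lemma preimagesD:
  assumes "\<sigma> \<in> preimages \<pi>"
  shows "stack_sort \<sigma> = \<pi>" "set \<sigma> = set \<pi>" "length \<sigma> = length \<pi>" "distinct \<sigma> \<longleftrightarrow> distinct \<pi>"
proof -
  show *: "stack_sort \<sigma> = \<pi>" using assms by (simp add: preimages_def)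
  show "set \<sigma> = set \<pi>" "length \<sigma> = length \<pi>" "distinct \<sigma> \<longleftrightarrow> distinct \<pi>"
    using set_stack_sort[of \<sigma>] length_stack_sort[of \<sigma>] distinct_stack_sort[of \<sigma>]
    unfolding * by simp_all
qed

lemma finite_preimages [simp]: "finite (preimages \<pi>)"
proof (rule finite_subset)
  show "preimages \<pi> \<subseteq> {xs. set xs \<subseteq> set \<pi> \<and> length xs \<le> length \<pi>}"
    using preimagesD by fastforce
  show "finite {xs. set xs \<subseteq> set \<pi> \<and> length xs \<le> length \<pi>}" by (rule finite_lists_length_le) simp
qed

lemma fertility_Nil [simp]: "fertility [] = 1"
proof -
  have "preimages [] = {[]}" using preimagesD(3) by (fastforce simp: preimages_def stack_sort_def)
  thus ?thesis by (simp add: fertility_def)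
qed

text \<open>A stack-sorted word ends with its largest entry. This is the source of all vanishing
  terms in \<open>fertility_decomposition\<close>.\<close>

lemma fertility_eq_0:
  assumes "distinct (xs @ [n])" "x \<in> set xs" "n < x"
  shows "fertility (xs @ [n]) = 0"
proof -
  have False if "stack_sort s = xs @ [n]" for s
  proof -
    have "distinct s" using assms(1) that by (metis distinct_stack_sort)
    moreover have "x \<in> set s" using assms(2) that set_stack_sort[of s] by auto
    ultimately show False using last_stack_sort[of s x] that assms(3) by simp
  qed
  hence "preimages (xs @ [n]) = {}" by (auto simp: preimages_def)
  thus ?thesis by (simp add: fertility_def)
qed

text \<open>A preimage is \<open>l @ n # r\<close> with \<open>l\<close> and \<open>r\<close>
  preimages of the two pieces of \<open>xs\<close>. The cut behind all of \<open>xs\<close> leaves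
  \<open>r\<close> empty and \<open>n\<close> without a descent, hence the separate first
  summand.\<close>

lemma fertility_snoc:
  assumes "distinct xs" "\<forall>x \<in> set xs. x < n"
  shows "fertility (xs @ [n]) = fertility xs
    + fps_X * (\<Sum>i<length xs. fertility (take i xs) * fertility (drop i xs))"
proof -
  let ?N = "length xs"
  let ?I = "SIGMA i:{..?N}. preimages (take i xs) \<times> preimages (drop i xs)"
  let ?f = "\<lambda>(i::nat, l, r). l @ n # r"
  let ?w = "\<lambda>i. if i < ?N then fps_X else (1 :: real fps)"
  have lt: "x < n" if "(i, l, r) \<in> ?I" "x \<in> set l \<union> set r" for i l r x
  proof -
    have "set l = set (take i xs)" "set r = set (drop i xs)"
      using that(1) preimagesD(2) by auto
    then show ?thesis using assms(2) that(2) by (auto dest: in_set_takeD in_set_dropD)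
  qed
  have inj: "inj_on ?f ?I"
  proof (rule inj_onI)
    fix z z' assume z: "z \<in> ?I" "z' \<in> ?I" "?f z = ?f z'"
    obtain i l r i' l' r' where zz: "z = (i, l, r)" "z' = (i', l', r')" by (metis prod.exhaust)
    have a: "(i, l, r) \<in> ?I" "(i', l', r') \<in> ?I" and eq: "l @ n # r = l' @ n # r'"
      using z zz by auto
    have "n \<notin> set l" "n \<notin> set r" "n \<notin> set l'" "n \<notin> set r'" using lt a by blast+
    hence "l = l'" "r = r'" using eq by (auto simp: append_Cons_eq_iff)
    moreover have "length l = i" "length l' = i'"
      using a preimagesD(3)[of l] preimagesD(3)[of l'] by auto
    ultimately show "z = z'" by (simp add: zz)
  qed
  have im: "?f ` ?I = preimages (xs @ [n])"
  proof (intro equalityI subsetI)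
    fix s assume "s \<in> ?f ` ?I"
    then obtain i l r where *: "(i, l, r) \<in> ?I" "s = l @ n # r" by auto
    have "\<forall>x \<in> set l \<union> set r. x < n" using lt *(1) by blast
    hence "stack_sort s = stack_sort l @ stack_sort r @ [n]" using * by (simp add: stack_sort_split)
    with * show "s \<in> preimages (xs @ [n])" by (auto simp: preimages_def)
  next
    fix s assume "s \<in> preimages (xs @ [n])"
    hence s: "stack_sort s = xs @ [n]" by (simp add: preimages_def)
    have "distinct (xs @ [n])" using assms by auto
    hence "distinct s" "s \<noteq> []" using s by (metis distinct_stack_sort, auto simp: stack_sort_def)
    then obtain l m r where lmr: "s = l @ m # r" "\<forall>x \<in> set l \<union> set r. x < m"
      using distinct_split_at_max by metis
    hence "xs = stack_sort l @ stack_sort r" "m = n"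
      using s by (auto simp: stack_sort_split)
    hence "(length l, l, r) \<in> ?I" by (auto simp: preimages_def)
    with lmr \<open>m = n\<close> show "s \<in> ?f ` ?I" by (auto intro!: image_eqI[of _ _ "(length l, l, r)"])
  qed
  have w: "fps_X ^ card (descents (?f z)) =
      (case z of (i, l, r) \<Rightarrow> ?w i * (fps_X ^ card (descents l) * fps_X ^ card (descents r)))"
    if "z \<in> ?I" for z
  proof -
    obtain i l r where z: "z = (i, l, r)" by (cases z)
    have "length r = ?N - i" using that preimagesD(3)[of r] by (auto simp: z)
    hence "r = [] \<longleftrightarrow> \<not> i < ?N" by (metis length_0_conv diff_is_0_eq not_less)
    moreover have "\<forall>x \<in> set l \<union> set r. x < n" using lt that z by blast
    ultimately show ?thesis by (auto simp: z card_descents_append_max power_add)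
  qed
  have "fertility (xs @ [n]) = (\<Sum>z\<in>?I. fps_X ^ card (descents (?f z)))"
    unfolding fertility_def im[symmetric] by (simp add: sum.reindex[OF inj])
  also have "\<dots> = (\<Sum>(i, l, r)\<in>?I. ?w i * (fps_X ^ card (descents l) * fps_X ^ card (descents r)))"
    by (rule sum.cong[OF refl w])
  also have "\<dots> = (\<Sum>i\<le>?N. \<Sum>(l, r)\<in>preimages (take i xs) \<times> preimages (drop i xs).
      ?w i * (fps_X ^ card (descents l) * fps_X ^ card (descents r)))"
    by (subst sum.Sigma) auto
  also have "\<dots> = (\<Sum>i\<le>?N. ?w i * (fertility (take i xs) * fertility (drop i xs)))"
    unfolding fertility_def sum_product by (simp only: sum_distrib_left) (simp only: sum.cartesian_product)
  also have "\<dots> = fertility xs + fps_X * (\<Sum>i<?N. fertility (take i xs) * fertility (drop i xs))"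
    by (simp add: lessThan_Suc_atMost[symmetric] sum_distrib_left)
  finally show ?thesis .
qed


section \<open>Decomposition along the entries above the largest descent\<close>

lemma sum_lessThan_add:
  fixes f :: "nat \<Rightarrow> 'a :: comm_monoid_add"
  shows "(\<Sum>i<m + n. f i) = (\<Sum>i<m. f i) + (\<Sum>i<n. f (m + i))"
  by (induction n) (auto simp: add.assoc)

text \<open>Exchanges a cut \<open>r\<close> of the tail and a removed index \<open>j\<close> before
  it for \<open>j\<close> and a cut \<open>i\<close> of what remains behind
  \<open>j\<close>.\<close>

lemma sum_triangle_shift:
  fixes f :: "nat \<Rightarrow> nat \<Rightarrow> 'a :: comm_monoid_add"
  shows "(\<Sum>r<N. \<Sum>j<r. f j r) = (\<Sum>j<N. \<Sum>i<N - Suc j. f j (Suc j + i))"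
  unfolding sum.Sigma[OF finite_lessThan ballI[OF finite_lessThan]]
  by (rule sum.reindex_bij_witness[of _ "\<lambda>(j, i). (Suc j + i, j)" "\<lambda>(r, j). (j, r - Suc j)"]) auto

text \<open>\<open>M\<close> is the entry at the descent, \<open>ts\<close> the increasing tail and
  \<open>ts ! j\<close> the entry at position t. The induction strips the last tail entry, which is
  the maximum of the word. It generalizes \<open>a\<close> because a cut to the left of
  \<open>M\<close> leaves a suffix that begins with a shorter \<open>a\<close>.\<close>

lemma fertility_decomposition:
  assumes "distinct (a @ M # b @ ts)" "b \<noteq> []" "\<forall>x \<in> set a \<union> set b. x < M"
    and "\<forall>t \<in> set ts. M < t" "sorted ts"
  shows "fertility (a @ M # b @ ts) = fps_X * (\<Sum>j<length ts.
    fertility (a @ M # drop (Suc j) ts) * fertility (b @ take j ts))"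
  using assms
proof (induction "length ts" arbitrary: a ts rule: less_induct)
  case less
  show ?case
  proof (cases ts rule: rev_exhaust)
    case Nil
    \<comment> \<open>With an empty tail the word ends in an entry below \<open>M\<close>, so both
      sides are 0.\<close>
    obtain b' n where b: "b = b' @ [n]" using less.prems(2) by (meson rev_exhaust)
    have "fertility ((a @ M # b') @ [n]) = 0"
      by (rule fertility_eq_0[of _ _ M]) (use less.prems in \<open>auto simp: Nil b\<close>)
    with Nil b show ?thesis by simp
  next
    case (snoc us t)
    let ?F = fertility and ?N = "length us" and ?w = "a @ M # b @ us"
    let ?G = "\<lambda>j. ?F (b @ take j us)"
    have dist: "distinct ?w" and lt: "\<forall>x \<in> set ?w. x < t" and M: "\<forall>t\<in>set us. M < t" "sorted us"
      using less.prems by (auto simp: snoc sorted_append order_le_less intro: less_trans)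
    have IH: "?F (a' @ M # b @ us') = fps_X * (\<Sum>j<length us'. ?F (a' @ M # drop (Suc j) us') * ?F (b @ take j us'))"
      if "length us' \<le> ?N" "set us' \<subseteq> set us" "set a' \<subseteq> set a" "distinct (a' @ M # b @ us')" "sorted us'" for a' us'
      using that less.prems M by (intro less.hyps) (auto simp: snoc)
    let ?la = "length a" and ?lb = "length b"
    \<comment> \<open>\<open>fertility_snoc\<close> with the cuts sorted by whether \<open>M\<close>
      falls into the right or the left piece.\<close>
    have rec: "?F ((a' @ M # v) @ [t]) = ?F (a' @ M # v) + fps_X * (
          (\<Sum>i\<le>length a'. ?F (take i a') * ?F (drop i a' @ M # v))
        + (\<Sum>i<length v. ?F (a' @ M # take i v) * ?F (drop i v)))"
      if "distinct (a' @ M # v)" "\<forall>x \<in> set (a' @ M # v). x < t" for a' v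
    proof -
      let ?g = "\<lambda>i. ?F (take i (a' @ M # v)) * ?F (drop i (a' @ M # v))"
      have "(\<Sum>i<Suc (length a') + length v. ?g i) =
        (\<Sum>i\<le>length a'. ?F (take i a') * ?F (drop i a' @ M # v))
        + (\<Sum>i<length v. ?F (a' @ M # take i v) * ?F (drop i v))"
        unfolding sum_lessThan_add lessThan_Suc_atMost by (intro arg_cong2[of _ _ _ _ "(+)"] sum.cong) auto
      thus ?thesis using fertility_snoc[OF that] by simp
    qed
    have vanish: "?F (a @ M # take i b) = 0" if i: "0 < i" "i < ?lb" for i
    proof -
      obtain b' n where b': "take i b = b' @ [n]"
        using i less.prems(2) by (cases "take i b" rule: rev_cases) auto
      have "n \<in> set b" by (metis b' in_set_conv_decomp in_set_takeD)
      moreover have "distinct (a @ M # take i b)" using dist by (auto dest: in_set_takeD)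
      ultimately have "?F ((a @ M # b') @ [n]) = 0"
        using less.prems(3) by (intro fertility_eq_0[of _ _ M]) (auto simp: b')
      thus ?thesis by (simp add: b')
    qed
    \<comment> \<open>Among the cuts inside \<open>b\<close> only the one directly behind
      \<open>M\<close> survives; it becomes the summand for \<open>j = length us\<close>, that is,
      for \<open>t\<close> itself.\<close>
    have main: "(\<Sum>i<length (b @ us). ?F (a @ M # take i (b @ us)) * ?F (drop i (b @ us))) =
       ?F (a @ [M]) * ?F (b @ us) + (\<Sum>r<?N. ?F (a @ M # b @ take r us) * ?F (drop r us))"
    proof -
      have "(\<Sum>i<?lb. ?F (a @ M # take i b) * ?F (drop i b @ us)) =
        (\<Sum>i<?lb. if i = 0 then ?F (a @ [M]) * ?F (b @ us) else 0)"
        by (intro sum.cong) (auto simp: vanish)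
      also have "\<dots> = ?F (a @ [M]) * ?F (b @ us)" using less.prems(2) by simp
      finally show ?thesis by (simp add: sum_lessThan_add)
    qed
    have A: "(\<Sum>i\<le>?la. ?F (take i a) * ?F (drop i a @ M # b @ us)) =
      fps_X * (\<Sum>j<?N. (\<Sum>i\<le>?la. ?F (take i a) * ?F (drop i a @ M # drop (Suc j) us)) * ?G j)"
    proof -
      have "?F (drop i a @ M # b @ us) = fps_X * (\<Sum>j<?N. ?F (drop i a @ M # drop (Suc j) us) * ?G j)" for i
        using dist M by (intro IH) (auto dest: in_set_dropD)
      hence "(\<Sum>i\<le>?la. ?F (take i a) * ?F (drop i a @ M # b @ us)) =
        fps_X * (\<Sum>i\<le>?la. \<Sum>j<?N. ?F (take i a) * ?F (drop i a @ M # drop (Suc j) us) * ?G j)"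
        by (simp add: sum_distrib_left mult.assoc mult.left_commute)
      thus ?thesis by (subst (asm) sum.swap) (simp add: sum_distrib_right)
    qed
    have B: "(\<Sum>r<?N. ?F (a @ M # b @ take r us) * ?F (drop r us)) =
      fps_X * (\<Sum>j<?N. (\<Sum>i<?N - Suc j. ?F (a @ M # take i (drop (Suc j) us)) * ?F (drop i (drop (Suc j) us))) * ?G j)"
    proof -
      let ?H = "\<lambda>j r. ?F (a @ M # drop (Suc j) (take r us)) * ?G j * ?F (drop r us)"
      have "?F (a @ M # b @ take r us) = fps_X * (\<Sum>j<r. ?F (a @ M # drop (Suc j) (take r us)) * ?G j)" if "r < ?N" for r
      proof -
        have "?F (a @ M # b @ take r us) =
          fps_X * (\<Sum>j<length (take r us). ?F (a @ M # drop (Suc j) (take r us)) * ?F (b @ take j (take r us)))"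
          using dist M by (intro IH) (auto dest: in_set_takeD intro: sorted_wrt_take)
        thus ?thesis using that by simp
      qed
      hence "(\<Sum>r<?N. ?F (a @ M # b @ take r us) * ?F (drop r us)) = fps_X * (\<Sum>r<?N. \<Sum>j<r. ?H j r)"
        by (simp add: sum_distrib_left sum_distrib_right mult.assoc)
      also have "(\<Sum>r<?N. \<Sum>j<r. ?H j r) = (\<Sum>j<?N. \<Sum>i<?N - Suc j. ?H j (Suc j + i))"
        by (rule sum_triangle_shift)
      also have "\<dots> = (\<Sum>j<?N. \<Sum>i<?N - Suc j. ?F (a @ M # take i (drop (Suc j) us)) * ?F (drop i (drop (Suc j) us)) * ?G j)"
        by (intro sum.cong refl) (simp add: drop_take add.commute mult.assoc mult.commute[of "?G _"])
      finally show ?thesis by (simp add: sum_distrib_right)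
    qed
    \<comment> \<open>This is \<open>rec\<close> for the left factor with \<open>t\<close> appended.
      It reassembles the parts of \<open>A\<close>, \<open>B\<close> and \<open>D\<close> that
      belong to the same \<open>j\<close>.\<close>
    have C: "?F (a @ M # drop (Suc j) us @ [t]) = ?F (a @ M # drop (Suc j) us) + fps_X * (
          (\<Sum>i\<le>?la. ?F (take i a) * ?F (drop i a @ M # drop (Suc j) us))
        + (\<Sum>i<?N - Suc j. ?F (a @ M # take i (drop (Suc j) us)) * ?F (drop i (drop (Suc j) us))))" for j
      using rec[of a "drop (Suc j) us"] dist lt by (auto dest: in_set_dropD)
    have D: "?F ?w = fps_X * (\<Sum>j<?N. ?F (a @ M # drop (Suc j) us) * ?G j)"
      using dist M by (intro IH) auto
    have "?F (a @ M # b @ ts) = ?F ((a @ M # b @ us) @ [t])" by (simp add: snoc)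
    also have "\<dots> = ?F ?w + fps_X * ((\<Sum>i\<le>?la. ?F (take i a) * ?F (drop i a @ M # b @ us)) +
       (?F (a @ [M]) * ?F (b @ us) + (\<Sum>r<?N. ?F (a @ M # b @ take r us) * ?F (drop r us))))"
      using rec[OF dist lt] by (simp only: main)
    also have "\<dots> = fps_X * ((\<Sum>j<?N. ?F (a @ M # drop (Suc j) us @ [t]) * ?G j) + ?F (a @ [M]) * ?F (b @ us))"
      unfolding A B C D by (simp add: algebra_simps sum.distrib sum_distrib_left)
    also have "\<dots> = fps_X * (\<Sum>j<length ts. ?F (a @ M # drop (Suc j) ts) * ?F (b @ take j ts))"
      by (simp add: snoc)
    finally show ?thesis .
  qed
qed

section \<open>Lagrange inversion for the Narayana recursion\<close>

text \<open>For i \<ge> q the product is a power series; for i = q - 1 it is the logarithmic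
  derivative of \<open>f\<close>, whose residue is the subdegree 1; otherwise it is a nonzero
  constant times the derivative of a power of 1/f, and derivatives have residue 0.\<close>

lemma residue_deriv_times_power:
  fixes f :: "'a :: field_char_0 fls"
  assumes "fls_subdegree f = 1" "q \<ge> 1"
  shows "fls_residue (fls_deriv f * f ^ i * inverse f ^ q) = (if Suc i = q then 1 else 0)"
proof -
  have f0: "f \<noteq> 0" using assms(1) by auto
  consider "i \<ge> q" | "Suc i = q" | "Suc i < q" by linarith
  then show ?thesis
  proof cases
    case 1
    have "f ^ i * inverse f ^ q = f ^ (i - q)"
      using f0 1 by (simp add: power_diff power_inverse divide_inverse)
    moreover have "fls_subdegree (fls_deriv f) \<ge> 0" using fls_subdegree_deriv[of f] assms by simp
    hence "fls_subdegree (fls_deriv f * f ^ (i - q)) \<ge> 0"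
      by (cases "fls_deriv f = 0") (use f0 assms in \<open>auto simp: fls_subdegree_mult fls_subdegree_pow\<close>)
    ultimately show ?thesis using 1 by (simp only: mult.assoc fls_residue_power_series) simp
  next
    case 2
    hence "f ^ i * inverse f ^ q = inverse f" using f0 by (auto simp: power_inverse field_simps)
    thus ?thesis using 2 fls_residue_deriv_times_inverse_eq_subdegree(1)[of f] assms
      by (simp add: mult.assoc)
  next
    case 3
    then obtain p where p: "q = i + (p + 2)" by (metis add_2_eq_Suc' less_natE add.commute add_Suc_right add_Suc)
    have "f ^ i * inverse f ^ q = inverse f ^ (p + 2)" using f0 by (simp add: p power_add power_inverse)
    moreover have "fls_deriv (inverse f ^ (p + 1)) = of_nat (p + 1) * (- (fls_deriv f * inverse f ^ (p + 2)))"
      unfolding fls_deriv_power fls_inverse_deriv by (simp add: power2_eq_square)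
    hence "fls_residue (of_nat (p + 1) * (- (fls_deriv f * inverse f ^ (p + 2)))) = 0"
      by (metis fls_residue_deriv)
    hence "of_nat (p + 1) * fls_residue (fls_deriv f * inverse f ^ (p + 2)) = 0"
      by (simp add: fls_of_nat)
    ultimately show ?thesis using 3 by (simp add: mult.assoc del: of_nat_add of_nat_Suc)
  qed
qed

text \<open>
  With $f = \sum_{q \ge 1} c_q z^q$ the recurrence says $f = z (1 + f) (1 + x f)$, and the
  coefficients of $f$ are read off by Lagrange inversion.
\<close>

lemma narayana_recurrence_solution:
  fixes c :: "nat \<Rightarrow> 'a :: field_char_0"
  assumes c0: "c 0 = 1" and c: "\<And>q. c (Suc q) = c q + x * (\<Sum>i<q. c i * c (q - i))" and "q \<ge> 1"
  shows "of_nat q * c q = (\<Sum>b<q. of_nat (q choose (Suc b)) * of_nat (q choose b) * x ^ b)"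
proof -
  \<comment> \<open>The constant term is set to 0 so that \<open>g\<close> has subdegree 1;
    \<open>1 + g\<close> is the full generating function of \<open>c\<close>.\<close>
  define g where "g = Abs_fps (\<lambda>q. if q = 0 then 0 else c q)"
  have g0: "g $ 0 = 0" and gS: "g $ Suc n = c (Suc n)" for n by (simp_all add: g_def)
  have g: "g = fps_X * ((1 + g) * (1 + fps_const x * g))"
  proof (rule fps_ext)
    fix n
    have "((1 + g) * g) $ q = (\<Sum>i<q. c i * c (q - i))" for q
    proof -
      have "((1 + g) * g) $ q = (\<Sum>i\<le>q. (1 + g) $ i * g $ (q - i))" by (simp add: fps_mult_nth atMost_atLeast0)
      also have "\<dots> = (\<Sum>i<q. (1 + g) $ i * g $ (q - i))" by (simp add: lessThan_Suc_atMost[symmetric] g_def)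
      also have "\<dots> = (\<Sum>i<q. c i * c (q - i))" by (intro sum.cong) (auto simp: g_def c0)
      finally show ?thesis .
    qed
    moreover have "(1 + g) * (1 + fps_const x * g) = (1 + g) + fps_const x * ((1 + g) * g)"
      by (simp add: algebra_simps)
    moreover have "(1 + g) $ q = c q" for q by (simp add: g_def c0)
    ultimately have "((1 + g) * (1 + fps_const x * g)) $ q = c (Suc q)" for q
      by (simp add: c)
    thus "g $ n = (fps_X * ((1 + g) * (1 + fps_const x * g))) $ n"
      by (cases n) (simp_all add: g0 gS)
  qed
  define f where "f = fps_to_fls g"
  have fX: "f = fls_X * ((1 + f) * (1 + fls_const x * f))"
  proof -
    have "f = fps_to_fls (fps_X * ((1 + g) * (1 + fps_const x * g)))" using g by (simp add: f_def)
    thus ?thesis by (simp add: fls_times_fps_to_fls f_def)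
  qed
  have g1: "g $ 1 = 1" using gS[of 0] c[of 0] c0 by simp
  hence "g \<noteq> 0" by auto
  hence f0: "f \<noteq> 0" by (simp add: f_def)
  have sub: "fls_subdegree f = 1"
    using subdegreeI[of g 1] g0 g1 by (simp add: f_def fls_subdegree_fls_to_fps)
  \<comment> \<open>The functional equation solved for 1/z; its q-th power becomes a combination of
    powers of \<open>f\<close>.\<close>
  have "inverse fls_X ^ q = ((1 + f) * (1 + fls_const x * f)) ^ q * inverse f ^ q"
  proof -
    have "inverse fls_X = ((1 + f) * (1 + fls_const x * f)) * inverse f"
    proof (rule inverse_unique)
      have "f * inverse f = fls_X * ((1 + f) * (1 + fls_const x * f)) * inverse f" using fX by metis
      thus "fls_X * ((1 + f) * (1 + fls_const x * f) * inverse f) = 1"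
        by (metis f0 right_inverse mult.assoc)
    qed
    thus ?thesis by (simp only: power_mult_distrib)
  qed
  also have "((1 + f) * (1 + fls_const x * f)) ^ q = 
      (\<Sum>a\<le>q. of_nat (q choose a) * f ^ a) * (\<Sum>b\<le>q. of_nat (q choose b) * (fls_const x * f) ^ b)"
    using binomial_ring[of f 1 q] binomial_ring[of "fls_const x * f" 1 q]
    by (simp add: power_mult_distrib add.commute)
  also have "\<dots> = (\<Sum>b\<le>q. \<Sum>a\<le>q. fls_const (of_nat (q choose a) * of_nat (q choose b) * x ^ b) * f ^ (a + b))"
  proof -
    have "of_nat (q choose a) * f ^ a * (of_nat (q choose b) * (fls_const x * f) ^ b) =
      fls_const (of_nat (q choose a) * of_nat (q choose b) * x ^ b) * f ^ (a + b)" for a b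
      unfolding fls_const_mult_const[symmetric] fls_const_power power_mult_distrib power_add fls_of_nat
      by (simp only: ac_simps)
    thus ?thesis unfolding sum_product by (subst sum.swap) (simp only:)
  qed
  finally have X: "inverse fls_X ^ q = \<dots> * inverse f ^ q" .
  \<comment> \<open>The coefficient of z^(q-1) in the derivative of \<open>f\<close> is q times the
    coefficient of z^q in \<open>f\<close>.\<close>
  have "of_nat q * c q = fls_residue (fls_deriv f * inverse fls_X ^ q)"
  proof -
    have "inverse fls_X ^ q = (fls_X_intpow (- int q) :: 'a fls)" 
      by (simp add: fls_inverse_X fls_X_inv_power_conv_shift_1)
    hence "fls_deriv f * inverse fls_X ^ q = fls_shift (int q) (fls_deriv f)"
      by (simp add: fls_shifted_times_simps)
    moreover obtain p where "q = Suc p" using \<open>q \<ge> 1\<close> by (cases q) auto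
    ultimately show ?thesis by (simp add: f_def gS nat_add_distrib)
  qed
  also have "\<dots> = (\<Sum>b\<le>q. \<Sum>a\<le>q. of_nat (q choose a) * of_nat (q choose b) * x ^ b *
      fls_residue (fls_deriv f * f ^ (a + b) * inverse f ^ q))"
  proof -
    have "fls_deriv f * inverse fls_X ^ q = (\<Sum>b\<le>q. \<Sum>a\<le>q. fls_const (of_nat (q choose a) * of_nat (q choose b) * x ^ b) *
      (fls_deriv f * f ^ (a + b) * inverse f ^ q))"
      by (simp only: X sum_distrib_left sum_distrib_right) (simp only: ac_simps)
    thus ?thesis by (simp only: fls_residue_def fls_nth_sum fls_mult_const_nth)
  qed
  \<comment> \<open>Only the power f^(q-1) has a nonzero residue here. It leaves a = q - 1 - b,
    which the symmetry of the binomial coefficients turns into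
    \<open>q choose Suc b\<close>.\<close>
  also have "\<dots> = (\<Sum>b\<le>q. \<Sum>a\<le>q. if a + b = q - 1 then of_nat (q choose a) * of_nat (q choose b) * x ^ b else 0)"
    using residue_deriv_times_power[OF sub \<open>q \<ge> 1\<close>] \<open>q \<ge> 1\<close> by (intro sum.cong refl) auto
  also have "\<dots> = (\<Sum>b\<le>q. if b < q then of_nat (q choose (Suc b)) * of_nat (q choose b) * x ^ b else 0)"
  proof (intro sum.cong refl)
    fix b assume "b \<in> {..q}"
    show "(\<Sum>a\<le>q. if a + b = q - 1 then of_nat (q choose a) * of_nat (q choose b) * x ^ b else 0) =
      (if b < q then of_nat (q choose (Suc b)) * of_nat (q choose b) * x ^ b else 0)"
    proof (cases "b < q")
      case True
      hence "a + b = q - 1 \<longleftrightarrow> a = q - Suc b" for a by auto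
      with True show ?thesis by (simp add: binomial_symmetric[of "Suc b" q])
    qed (use \<open>q \<ge> 1\<close> in \<open>auto intro!: sum.neutral\<close>)
  qed
  also have "\<dots> = (\<Sum>b<q. of_nat (q choose (Suc b)) * of_nat (q choose b) * x ^ b)"
    by (simp add: lessThan_Suc_atMost[symmetric])
  finally show ?thesis .
qed

section \<open>Increasing words\<close>

text \<open>
  Because of division by zero \<open>narayana_series 0\<close> is $0$ and not $1$, the fertility of the empty word.
\<close>

definition narayana_series :: "nat \<Rightarrow> real fps" where
  "narayana_series q = Abs_fps (\<lambda>j. narayana q (j + 1))"

lemma fps_to_fls_sum: "fps_to_fls (\<Sum>x\<in>A. f x) = (\<Sum>x\<in>A. fps_to_fls (f x))"
  by (induction A rule: infinite_finite_induct) auto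

text \<open>For increasing words \<open>fertility_snoc\<close> only involves shorter increasing
  words, so the recursion sees nothing but lengths.\<close>

lemma fertility_sorted_length:
  assumes "sorted_wrt (<) xs"
  shows "fertility xs = fertility [0..<length xs]"
  using assms
proof (induction "length xs" arbitrary: xs rule: less_induct)
  case less
  show ?case
  proof (cases xs rule: rev_exhaust)
    case (snoc ys n)
    have ys: "sorted_wrt (<) ys" "\<forall>y \<in> set ys. y < n"
      using less.prems by (auto simp: snoc sorted_wrt_append)
    have IH: "fertility zs = fertility [0..<length zs]"
      if "length zs \<le> length ys" "sorted_wrt (<) zs" for zs
      by (rule less.hyps) (use that in \<open>auto simp: snoc\<close>)
    have step: "fertility (zs @ [m]) = fertility [0..<length ys] + fps_X *
        (\<Sum>i<length ys. fertility [0..<i] * fertility [0..<length ys - i])"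
      if "length zs = length ys" "sorted_wrt (<) zs" "\<forall>z \<in> set zs. z < m" for zs m
    proof -
      have "fertility (take i zs) = fertility [0..<i]" "fertility (drop i zs) = fertility [0..<length ys - i]"
        if "i < length ys" for i
        using IH[of "take i zs"] IH[of "drop i zs"] \<open>length zs = length ys\<close> \<open>sorted_wrt (<) zs\<close> that
        by (simp_all add: sorted_wrt_take sorted_wrt_drop)
      moreover have "distinct zs" using that by (simp add: strict_sorted_iff)
      ultimately show ?thesis using that IH[of zs] by (simp add: fertility_snoc)
    qed
    from step[of ys n] step[of "[0..<length ys]" "length ys"] ys show ?thesis
      by (simp add: snoc)
  qed simp
qed

lemma fertility_sorted:
  assumes "sorted_wrt (<) xs" "xs \<noteq> []"
  shows "fertility xs = narayana_series (length xs)"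
proof -
  define q where "q = length xs"
  have q: "q \<ge> 1" using assms(2) by (cases xs) (auto simp: q_def)
  \<comment> \<open>The solution of the recurrence is stated over a field, so the fertilities move
    into Laurent series in the descent variable, which takes the role of \<open>x\<close>. The
    variable z of the Lagrange inversion counts letters.\<close>
  define c where "c i = fps_to_fls (fertility [0..<i])" for i
  have "c 0 = 1" by (simp add: c_def)
  moreover have "c (Suc q) = c q + fls_X * (\<Sum>i<q. c i * c (q - i))" for q
  proof -
    have "fertility [0..<Suc q] = fertility [0..<q] + fps_X * (\<Sum>i<q. fertility (take i [0..<q]) * fertility (drop i [0..<q]))"
      unfolding upt_Suc_append[OF le0] by (subst fertility_snoc) auto
    also have "(\<Sum>i<q. fertility (take i [0..<q]) * fertility (drop i [0..<q])) =
      (\<Sum>i<q. fertility [0..<i] * fertility [0..<q - i])"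
    proof (intro sum.cong refl)
      fix i assume "i \<in> {..<q}"
      thus "fertility (take i [0..<q]) * fertility (drop i [0..<q]) = fertility [0..<i] * fertility [0..<q - i]"
        using fertility_sorted_length[of "[i..<q]"] by (simp add: take_upt drop_upt)
    qed
    finally show ?thesis by (simp add: c_def fls_times_fps_to_fls fps_to_fls_sum)
  qed
  ultimately have "of_nat q * c q = (\<Sum>b<q. of_nat (q choose (Suc b)) * of_nat (q choose b) * fls_X ^ b)"
    using q by (rule narayana_recurrence_solution)
  hence "fps_to_fls (of_nat q * fertility [0..<q]) =
    fps_to_fls (\<Sum>b<q. of_nat (q choose (Suc b)) * of_nat (q choose b) * fps_X ^ b)"
    by (simp add: c_def fls_times_fps_to_fls fps_to_fls_sum fps_to_fls_of_nat fps_to_fls_power)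
  hence eq: "of_nat q * fertility [0..<q] =
    (\<Sum>b<q. of_nat (q choose (Suc b)) * of_nat (q choose b) * fps_X ^ b)"
    by (simp only: fps_to_fls_eq_iff)
  have "fertility [0..<q] = narayana_series q"
  proof (rule fps_ext)
    fix j
    have "real q * fps_nth (fertility [0..<q]) j = fps_nth (of_nat q * fertility [0..<q]) j"
      by (simp only: fps_of_nat[symmetric] fps_mult_left_const_nth)
    also have "\<dots> = (\<Sum>b<q. if j = b then real (q choose (Suc b)) * real (q choose b) else 0)"
      unfolding eq fps_sum_nth
    proof (intro sum.cong refl)
      fix b
      have "of_nat (q choose (Suc b)) * of_nat (q choose b) * fps_X ^ b =
        fps_const (real (q choose (Suc b)) * real (q choose b)) * fps_X ^ b"
        by (simp only: fps_of_nat[symmetric] fps_const_mult)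
      thus "fps_nth (of_nat (q choose (Suc b)) * of_nat (q choose b) * fps_X ^ b :: real fps) j =
        (if j = b then real (q choose (Suc b)) * real (q choose b) else 0)"
        by (simp only: fps_mult_left_const_nth fps_X_power_nth) simp
    qed
    also have "\<dots> = real (q choose (Suc j)) * real (q choose j)"
      by (simp add: binomial_eq_0)
    finally show "fps_nth (fertility [0..<q]) j = fps_nth (narayana_series q) j"
      using q by (simp add: narayana_series_def narayana_def field_simps)
  qed
  thus ?thesis using fertility_sorted_length[OF assms(1)] by (simp add: q_def)
qed

section \<open>Hook maps\<close>

text \<open>
  A word is a finite set of positions together with a value function that stays fixed, so that
  passing to the subwords $U_t$ and $S_t$ requires no renumbering.
\<close>

definition word :: "(nat \<Rightarrow> nat) \<Rightarrow> nat set \<Rightarrow> nat list" where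
  "word v X = map v (sorted_list_of_set X)"

text \<open>Neighbours in a subword need not be neighbouring positions, so the successor is
  expressed by the absence of positions in between.\<close>

definition word_descents :: "(nat \<Rightarrow> nat) \<Rightarrow> nat set \<Rightarrow> nat set" where
  "word_descents v X = {i \<in> X. \<exists>j\<in>X. i < j \<and> v j < v i \<and> (\<forall>k\<in>X. \<not> (i < k \<and> k < j))}"

text \<open>The last condition is laminarity. \<open>h d = d'\<close> is allowed, since the two
  intervals then share a single point; nested intervals must have distinct right ends, which makes
  \<open>h\<close> injective.\<close>

definition hook_maps :: "(nat \<Rightarrow> nat) \<Rightarrow> nat set \<Rightarrow> (nat \<Rightarrow> nat) set" where
  "hook_maps v X = {h \<in> word_descents v X \<rightarrow>\<^sub>E X.
     (\<forall>d \<in> word_descents v X. d < h d \<and> v d < v (h d)) \<and>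
     (\<forall>d \<in> word_descents v X. \<forall>d' \<in> word_descents v X. d < d' \<longrightarrow> h d \<le> d' \<or> h d' < h d)}"

text \<open>
  A color is named by the southwest endpoint of its hook, and $0$, which is never a position, stands
  for $c_0$. By laminarity the lowest hook above a point is the one that starts farthest to the right.
\<close>

definition hook_color :: "nat set \<Rightarrow> (nat \<Rightarrow> nat) \<Rightarrow> nat \<Rightarrow> nat" where
  "hook_color D h p = Max (insert 0 {d \<in> D. d < p \<and> p < h d})"

text \<open>The northeast endpoints are left out because in the coloring they carry exactly the
  colors outside \<open>Theta\<close>.\<close>

definition hook_weight :: "(nat \<Rightarrow> nat) \<Rightarrow> nat set \<Rightarrow> (nat \<Rightarrow> nat) \<Rightarrow> real fps" where
  "hook_weight v X h = (\<Prod>c\<in>insert 0 (word_descents v X). narayana_series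
     (card {p \<in> X - h ` word_descents v X. hook_color (word_descents v X) h p = c}))"

lemma finite_word_descents [simp]: "finite X \<Longrightarrow> finite (word_descents v X)"
  by (rule finite_subset[of _ X]) (auto simp: word_descents_def)

lemma finite_hook_maps [simp]: "finite X \<Longrightarrow> finite (hook_maps v X)"
  by (rule finite_subset[of _ "word_descents v X \<rightarrow>\<^sub>E X"]) (auto simp: hook_maps_def intro!: finite_PiE)

text \<open>The last position before \<open>q\<close> whose value is at least \<open>v p\<close> is
  a descent: its successor is either \<open>q\<close> or has a value below
  \<open>v p\<close>.\<close>

lemma ex_word_descent_between:
  assumes "finite X" "p \<in> X" "q \<in> X" "p < q" "v q < v p"
  obtains d where "d \<in> word_descents v X" "p \<le> d" "d < q" "v p \<le> v d"
proof -
  let ?A = "{x \<in> X. p \<le> x \<and> x < q \<and> v p \<le> v x}"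
  have fin: "finite ?A" "?A \<noteq> {}" using assms by auto
  define d where "d = Max ?A"
  have dA: "d \<in> ?A" unfolding d_def using fin by (rule Max_in)
  let ?B = "{x \<in> X. d < x}"
  have finB: "finite ?B" "?B \<noteq> {}" using assms dA by auto
  define j where "j = Min ?B"
  have jB: "j \<in> ?B" unfolding j_def using finB by (rule Min_in)
  have jq: "j \<le> q" unfolding j_def using finB dA assms by (intro Min_le) auto
  have "v j < v d"
  proof (rule ccontr)
    assume "\<not> v j < v d"
    hence "j \<in> ?A" using jB jq dA assms by (cases "j = q") auto
    hence "j \<le> d" unfolding d_def using fin by (intro Max_ge)
    thus False using jB by simp
  qed
  moreover have "\<not> (d < k \<and> k < j)" if "k \<in> X" for k
    using that finB Min_le[of ?B k] by (auto simp: j_def)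
  ultimately have "d \<in> word_descents v X" using dA jB by (auto simp: word_descents_def)
  with dA that show thesis by blast
qed

lemma sorted_list_of_set_eqI:
  "sorted_wrt (<) xs \<Longrightarrow> set xs = A \<Longrightarrow> sorted_list_of_set A = (xs :: nat list)"
  by (metis sorted_list_of_set.idem_if_sorted_distinct strict_sorted_iff)

section \<open>Splitting a word at its largest descent\<close>

locale max_descent =
  fixes v :: "nat \<Rightarrow> nat" and X :: "nat set" and d :: nat
  assumes finite [simp]: "finite X" and inj: "inj_on v X" and pos: "0 \<notin> X"
    and d: "d \<in> word_descents v X" and max: "\<And>d'. d' \<in> word_descents v X \<Longrightarrow> v d' \<le> v d"
begin

definition D where "D = word_descents v X"
definition T where "T = {t \<in> X. v d < v t}"
definition U where "U t = {p \<in> X. p \<le> d \<or> t < p}"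
definition S where "S t = {p \<in> X. d < p \<and> p < t}"

lemma dX [simp]: "d \<in> X" and dD: "d \<in> D" and D_subset: "x \<in> D \<Longrightarrow> x \<in> X"
  using d by (auto simp: D_def word_descents_def)

text \<open>Keeps the color name \<open>d\<close> apart from 0, the name of the color without a
  hook.\<close>

lemma d_pos: "0 < d" using pos dX by (metis gr0I)

lemma inj_le: "v p \<le> v q \<Longrightarrow> p \<in> X \<Longrightarrow> q \<in> X \<Longrightarrow> p \<noteq> q \<Longrightarrow> v p < v q"
  using inj by (metis inj_on_contraD le_neq_implies_less)

text \<open>A drop after an entry above \<open>v d\<close> would force a descent with an entry
  larger than \<open>v d\<close>.\<close>

lemma tail_increasing: assumes "p \<in> X" "q \<in> X" "p < q" "v d < v p" shows "v p < v q"
proof (rule ccontr)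
  assume "\<not> v p < v q"
  hence "v q < v p" using assms inj_le[of q p] by simp
  then obtain d' where "d' \<in> word_descents v X" "v p \<le> v d'"
    using assms ex_word_descent_between[of X p q v] by auto
  with max[of d'] assms show False by simp
qed

lemma tail_after: "t \<in> T \<Longrightarrow> d < t"
  using tail_increasing[of t d] by (cases t d rule: linorder_cases) (auto simp: T_def)

lemma D_not_T: "x \<in> D \<Longrightarrow> x \<notin> T" using max by (fastforce simp: D_def T_def)

lemma tail_closed: "t \<in> T \<Longrightarrow> t \<le> p \<Longrightarrow> p \<in> X \<Longrightarrow> p \<in> T"
  using tail_increasing[of t p] by (cases "t = p") (auto simp: T_def)

lemma D_less_tail: assumes "x \<in> D" "t \<in> T" shows "x < t"
proof (rule ccontr)
  assume "\<not> x < t"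
  hence "x \<in> T" using tail_closed[of t x] assms D_subset by auto
  with assms D_not_T show False by blast
qed

lemma sub: "U t \<subseteq> X" "S t \<subseteq> X" by (auto simp: U_def S_def)

text \<open>Once (d, t] is removed, \<open>d\<close> is followed only by larger entries in
  increasing order, so neither \<open>d\<close> nor any later position is a descent. Nothing changes
  to the left of \<open>d\<close>.\<close>

lemma descents_U: assumes t: "t \<in> T" shows "word_descents v (U t) = {x \<in> D. x < d}"
proof (intro equalityI subsetI)
  fix x assume "x \<in> {x \<in> D. x < d}"
  then obtain j where j: "x \<in> X" "x < d" "j \<in> X" "x < j" "v j < v x" "\<forall>k\<in>X. \<not> (x < k \<and> k < j)"
    by (auto simp: D_def word_descents_def)
  hence "j \<le> d" using dX not_less by blast
  with j show "x \<in> word_descents v (U t)" by (auto simp: word_descents_def U_def)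
next
  fix x assume "x \<in> word_descents v (U t)"
  then obtain j where j: "x \<in> U t" "j \<in> U t" "x < j" "v j < v x" "\<And>k. k \<in> U t \<Longrightarrow> \<not> (x < k \<and> k < j)"
    by (auto simp: word_descents_def)
  have X: "x \<in> X" "j \<in> X" using j sub by auto
  have T: "p \<in> T" if "p \<in> U t" "d < p" for p using that tail_closed[OF t, of p] by (auto simp: U_def)
  have xd: "x < d"
  proof (rule ccontr)
    assume "\<not> x < d"
    hence "d < j" "x = d \<or> d < x" using j by auto
    hence "j \<in> T" "x = d \<or> x \<in> T" using T j by auto
    thus False using j tail_increasing[of x j] X by (auto simp: T_def)
  qed
  hence "j \<le> d" using j(5)[of d] by (auto simp: U_def)
  hence "\<not> (x < k \<and> k < j)" if "k \<in> X" for k using that j(5)[of k] by (auto simp: U_def)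
  with j X xd show "x \<in> {x \<in> D. x < d}" by (auto simp: D_def word_descents_def)
qed

text \<open>The successor of a descent behind \<open>d\<close> cannot be \<open>t\<close>, whose
  entry exceeds \<open>v d\<close> and hence the entry of every descent; so the successor survives
  in \<open>S t\<close>.\<close>

lemma descents_S: assumes t: "t \<in> T" shows "word_descents v (S t) = {x \<in> D. d < x}"
proof (intro equalityI subsetI)
  fix x assume x: "x \<in> {x \<in> D. d < x}"
  then obtain j where j: "x \<in> X" "d < x" "j \<in> X" "x < j" "v j < v x" "\<forall>k\<in>X. \<not> (x < k \<and> k < j)"
    by (auto simp: D_def word_descents_def)
  have "x < t" using D_less_tail x t by auto
  moreover have "t \<in> X" using t by (auto simp: T_def)
  ultimately have "j \<le> t" using j not_less by blast
  moreover have "v x \<le> v d" using max x by (auto simp: D_def)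
  hence "j \<noteq> t" using j t by (auto simp: T_def)
  ultimately show "x \<in> word_descents v (S t)" using j \<open>x < t\<close> by (auto simp: word_descents_def S_def)
next
  fix x assume "x \<in> word_descents v (S t)"
  thus "x \<in> {x \<in> D. d < x}" by (fastforce simp: word_descents_def S_def D_def)
qed

lemma U_smaller: assumes "t \<in> T" shows "card (U t) < card X"
proof (rule psubset_card_mono)
  have "t \<in> X" "t \<notin> U t" using assms tail_after[OF assms] by (auto simp: T_def U_def)
  thus "U t \<subset> X" using sub(1) by blast
qed simp

lemma S_smaller: "card (S t) < card X"
proof (rule psubset_card_mono)
  have "d \<notin> S t" by (simp add: S_def)
  thus "S t \<subset> X" using sub(2) dX by blast
qed simp

text \<open>Together with \<open>S_nonempty\<close> this keeps the induction away from the empty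
  word, whose fertility 1 differs from \<open>narayana_series 0\<close>.\<close>

lemma U_nonempty: "U t \<noteq> {}" by (auto simp: U_def intro!: exI[of _ d])

lemma next_d: obtains j where "j \<in> X" "d < j" "v j < v d"
  using d by (auto simp: word_descents_def)

lemma S_nonempty: assumes "t \<in> T" shows "S t \<noteq> {}"
proof -
  obtain j where j: "j \<in> X" "d < j" "v j < v d" by (rule next_d)
  have "j < t"
  proof (rule ccontr)
    assume "\<not> j < t"
    hence "j \<in> T" using tail_closed[OF assms, of j] j by simp
    with j show False by (simp add: T_def)
  qed
  with j show ?thesis by (auto simp: S_def)
qed

definition glue :: "nat \<Rightarrow> (nat \<Rightarrow> nat) \<Rightarrow> (nat \<Rightarrow> nat) \<Rightarrow> nat \<Rightarrow> nat" where
  "glue t h1 h2 x = (if x < d then h1 x else if x = d then t else h2 x)"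

text \<open>Targets in \<open>U t\<close> avoid (d, t] and targets in \<open>S t\<close> stay
  strictly between \<open>d\<close> and \<open>t\<close>. Hence no interval from either side crosses
  [d, t], nor one from the other side.\<close>

lemma glue_in_hook_maps:
  assumes t: "t \<in> T" and h1: "h1 \<in> hook_maps v (U t)" and h2: "h2 \<in> hook_maps v (S t)"
  shows "glue t h1 h2 \<in> hook_maps v X"
proof -
  let ?h = "glue t h1 h2"
  have H1: "h1 x \<in> U t" "x < h1 x" "v x < v (h1 x)" if "x \<in> D" "x < d" for x
    using h1 that descents_U[OF t] by (auto simp: hook_maps_def)
  have H2: "h2 x \<in> S t" "x < h2 x" "v x < v (h2 x)" if "x \<in> D" "d < x" for x
    using h2 that descents_S[OF t] by (auto simp: hook_maps_def)
  have L1: "h1 x \<le> y \<or> h1 y < h1 x" if "x \<in> D" "y \<in> D" "x < y" "y < d" for x y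
    using h1 that descents_U[OF t] by (auto simp: hook_maps_def)
  have L2: "h2 x \<le> y \<or> h2 y < h2 x" if "x \<in> D" "y \<in> D" "x < y" "d < x" for x y
    using h2 that descents_S[OF t] by (auto simp: hook_maps_def)
  have tT: "t \<in> X" "v d < v t" "d < t" using t tail_after by (auto simp: T_def)
  have "?h \<in> D \<rightarrow>\<^sub>E X"
  proof (rule PiE_I)
    fix x assume "x \<in> D"
    thus "?h x \<in> X" using H1[of x] H2[of x] tT sub[THEN subsetD] by (auto simp: glue_def)
  next
    fix x assume "x \<notin> D"
    moreover have "h1 \<in> extensional {x \<in> D. x < d}" "h2 \<in> extensional {x \<in> D. d < x}"
      using h1 h2 descents_U[OF t] descents_S[OF t] by (auto simp: hook_maps_def PiE_def)
    ultimately show "?h x = undefined" using dD by (auto simp: glue_def extensional_def)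
  qed
  moreover have "x < ?h x \<and> v x < v (?h x)" if "x \<in> D" for x
    using that H1[of x] H2[of x] tT by (auto simp: glue_def)
  moreover have "?h x \<le> y \<or> ?h y < ?h x" if "x \<in> D" "y \<in> D" "x < y" for x y
  proof -
    consider "y < d" | "x < d" "y = d" | "x < d" "d < y" | "x = d" | "d < x" using that by linarith
    thus ?thesis
    proof cases
      case 1
      then show ?thesis using that L1 by (auto simp: glue_def)
    next
      case 2
      then show ?thesis using that H1[of x] by (auto simp: glue_def U_def)
    next
      case 3
      then show ?thesis using that H1[of x] H2[of y] by (auto simp: glue_def U_def S_def)
    next
      case 4
      then show ?thesis using that H2[of y] by (auto simp: glue_def S_def)
    next
      case 5
      then show ?thesis using that L2 by (auto simp: glue_def)
    qed
  qed
  ultimately show ?thesis by (simp add: hook_maps_def D_def)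
qed

text \<open>Laminarity against \<open>d\<close> keeps earlier hooks from ending in (d, h d]. A later
  descent lies before \<open>h d\<close>, because descents precede the whole tail, so its hook must
  end before \<open>h d\<close> too.\<close>

lemma split_hook_map:
  assumes h: "h \<in> hook_maps v X"
  shows "h d \<in> T" "restrict h {x \<in> D. x < d} \<in> hook_maps v (U (h d))"
    "restrict h {x \<in> D. d < x} \<in> hook_maps v (S (h d))"
    "glue (h d) (restrict h {x \<in> D. x < d}) (restrict h {x \<in> D. d < x}) = h"
proof -
  have H: "h x \<in> X" "x < h x" "v x < v (h x)" if "x \<in> D" for x
    using h that by (auto simp: hook_maps_def D_def)
  have L: "h x \<le> y \<or> h y < h x" if "x \<in> D" "y \<in> D" "x < y" for x y
    using h that by (auto simp: hook_maps_def D_def)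
  show t: "h d \<in> T" using H[OF dD] by (simp add: T_def)
  show "restrict h {x \<in> D. x < d} \<in> hook_maps v (U (h d))"
    using H L L[OF _ dD] unfolding hook_maps_def descents_U[OF t] by (auto simp: U_def)
  show "restrict h {x \<in> D. d < x} \<in> hook_maps v (S (h d))"
  proof -
    have "h x \<in> S (h d)" if "x \<in> D" "d < x" for x
      using L[OF dD that] D_less_tail[OF that(1) t] H[OF that(1)] that by (auto simp: S_def)
    thus ?thesis using H L unfolding hook_maps_def descents_S[OF t] by auto
  qed
  have "h \<in> extensional D" using h by (auto simp: hook_maps_def PiE_def D_def)
  thus "glue (h d) (restrict h {x \<in> D. x < d}) (restrict h {x \<in> D. d < x}) = h"
    by (auto simp: glue_def extensional_def fun_eq_iff)
qed

text \<open>Hooks starting at \<open>d\<close> or later cover no point of \<open>U t\<close>, so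
  colors there are unchanged. On \<open>S t\<close> the hook from \<open>d\<close> covers every
  point and outranks all hooks from further left, so color 0 of \<open>S t\<close> is renamed to
  \<open>d\<close> and the other colors stay.\<close>

lemma weight_glue:
  assumes t: "t \<in> T" and h1: "h1 \<in> hook_maps v (U t)" and h2: "h2 \<in> hook_maps v (S t)"
  shows "hook_weight v X (glue t h1 h2) = hook_weight v (U t) h1 * hook_weight v (S t) h2"
proof -
  let ?h = "glue t h1 h2"
  let ?DU = "{x \<in> D. x < d}" and ?DS = "{x \<in> D. d < x}"
  let ?c = "hook_color D ?h" and ?cU = "hook_color ?DU h1" and ?cS = "hook_color ?DS h2"
  have H1: "h1 x \<in> U t" "x < h1 x" "v x < v (h1 x)" if "x \<in> D" "x < d" for x
    using h1 that descents_U[OF t] by (auto simp: hook_maps_def)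
  have H2: "h2 x \<in> S t" "x < h2 x" "v x < v (h2 x)" if "x \<in> D" "d < x" for x
    using h2 that descents_S[OF t] by (auto simp: hook_maps_def)
  have tT: "t \<in> X" "v d < v t" "d < t" using t tail_after by (auto simp: T_def)
  have finD: "finite D" by (simp add: D_def)
  have split_D: "insert 0 D = insert 0 ?DU \<union> insert d ?DS" "insert 0 ?DU \<inter> insert d ?DS = {}"
    using dD d_pos by auto
  have im: "?h ` D = h1 ` ?DU \<union> {t} \<union> h2 ` ?DS"
  proof -
    have "D = ?DU \<union> {d} \<union> ?DS" using dD by auto
    hence "?h ` D = ?h ` (?DU \<union> {d} \<union> ?DS)" by (rule arg_cong)
    also have "\<dots> = h1 ` ?DU \<union> {t} \<union> h2 ` ?DS" by (auto simp: glue_def image_Un)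
    finally show ?thesis .
  qed
  have img: "h1 ` ?DU \<subseteq> U t" "h2 ` ?DS \<subseteq> S t" using H1 H2 by auto
  \<comment> \<open>The point \<open>t\<close> is a northeast endpoint and lies in neither part, so
    it drops out on both sides.\<close>
  have cov: "X - ?h ` D = (U t - h1 ` ?DU) \<union> (S t - h2 ` ?DS)"
    using img tT unfolding im by (auto simp: U_def S_def)
  have colU: "?c p = ?cU p" if "p \<in> U t" for p
  proof -
    have "x < p \<and> p < ?h x \<longleftrightarrow> x < d \<and> x < p \<and> p < h1 x" if "x \<in> D" for x
      using H2(1)[of x] that \<open>p \<in> U t\<close> by (auto simp: glue_def U_def S_def)
    hence "{x \<in> D. x < p \<and> p < ?h x} = {x \<in> ?DU. x < p \<and> p < h1 x}" by blast
    thus ?thesis by (simp add: hook_color_def)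
  qed
  have cU: "?cU p \<in> insert 0 ?DU" for p
    using Max_in[of "insert 0 {x \<in> ?DU. x < p \<and> p < h1 x}"] finD by (auto simp: hook_color_def)
  have cS: "?cS p \<in> insert 0 ?DS" for p
    using Max_in[of "insert 0 {x \<in> ?DS. x < p \<and> p < h2 x}"] finD by (auto simp: hook_color_def)
  have colS: "?c p = (if ?cS p = 0 then d else ?cS p)" if p: "p \<in> S t" for p
  proof -
    let ?A = "{x \<in> ?DU. x < p \<and> p < h1 x}" and ?B = "{x \<in> ?DS. x < p \<and> p < h2 x}"
    have fin: "finite ?A" "finite ?B" using finD by auto
    have eq: "{x \<in> D. x < p \<and> p < ?h x} = insert d (?A \<union> ?B)"
      using p dD by (auto simp: glue_def S_def)
    have "?c p = Max (insert 0 (insert d (?A \<union> ?B)))" by (simp only: hook_color_def eq)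
    also have "\<dots> = Max (insert d ?B)"
      using fin by (intro Max_eq_if) auto
    also have "\<dots> = (if ?cS p = 0 then d else ?cS p)"
    proof (cases "?B = {}")
      case True
      show ?thesis unfolding hook_color_def True by simp
    next
      case False
      have "?cS p = Max ?B" unfolding hook_color_def using fin False by (simp add: Max_insert)
      moreover have "Max ?B \<in> ?B" using fin False by (intro Max_in)
      ultimately show ?thesis using fin False by (simp add: Max_insert)
    qed
    finally show ?thesis .
  qed
  have disj: "U t \<inter> S t = {}" by (auto simp: U_def S_def)
  have setU: "{p \<in> X - ?h ` D. ?c p = c} = {p \<in> U t - h1 ` ?DU. ?cU p = c}" if c: "c \<in> insert 0 ?DU" for c
  proof -
    have "?c p \<noteq> c" if "p \<in> S t" for p using colS[OF that] cS[of p] c d_pos by (auto split: if_splits)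
    thus ?thesis unfolding cov using colU by auto
  qed
  have setS: "{p \<in> X - ?h ` D. ?c p = c} = {p \<in> S t - h2 ` ?DS. ?cS p = (if c = d then 0 else c)}"
    if c: "c \<in> insert d ?DS" for c
  proof -
    have "?c p \<noteq> c" if "p \<in> U t" for p using colU[OF that] cU[of p] c d_pos by auto
    moreover have "?c p = c \<longleftrightarrow> ?cS p = (if c = d then 0 else c)" if "p \<in> S t" for p
      using colS[OF that] cS[of p] c by auto
    ultimately show ?thesis unfolding cov by blast
  qed
  let ?w = "\<lambda>c. narayana_series (card {p \<in> X - ?h ` D. ?c p = c})"
  have "hook_weight v X ?h = (\<Prod>c\<in>insert 0 ?DU. ?w c) * (\<Prod>c\<in>insert d ?DS. ?w c)"
    unfolding hook_weight_def D_def[symmetric] split_D(1)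
    using split_D(2) finD by (intro prod.union_disjoint) auto
  also have "(\<Prod>c\<in>insert 0 ?DU. ?w c) = hook_weight v (U t) h1"
    unfolding hook_weight_def descents_U[OF t] using setU by (intro prod.cong) auto
  also have "(\<Prod>c\<in>insert d ?DS. ?w c) = hook_weight v (S t) h2"
    unfolding hook_weight_def descents_S[OF t]
    by (rule prod.reindex_bij_witness[of _ "\<lambda>c. if c = 0 then d else c" "\<lambda>c. if c = d then 0 else c"])
      (use setS d_pos in auto)
  finally show ?thesis .
qed

lemma sum_hook_weight:
  "(\<Sum>h\<in>hook_maps v X. hook_weight v X h) =
   (\<Sum>t\<in>T. (\<Sum>h\<in>hook_maps v (U t). hook_weight v (U t) h) * (\<Sum>h\<in>hook_maps v (S t). hook_weight v (S t) h))"
proof -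
  let ?I = "SIGMA t:T. hook_maps v (U t) \<times> hook_maps v (S t)"
  have fin: "finite T" "finite (U t)" "finite (S t)" for t
    by (auto simp: T_def U_def S_def)
  have "(\<Sum>h\<in>hook_maps v X. hook_weight v X h) =
    (\<Sum>(t, h1, h2)\<in>?I. hook_weight v (U t) h1 * hook_weight v (S t) h2)"
  proof (rule sum.reindex_bij_witness[of _ "\<lambda>(t, h1, h2). glue t h1 h2"
      "\<lambda>h. (h d, restrict h {x \<in> D. x < d}, restrict h {x \<in> D. d < x})"])
    fix z assume "z \<in> ?I"
    then obtain t h1 h2 where z: "z = (t, h1, h2)"
      and a: "t \<in> T" "h1 \<in> hook_maps v (U t)" "h2 \<in> hook_maps v (S t)" by auto
    show "(case z of (t, h1, h2) \<Rightarrow> glue t h1 h2) \<in> hook_maps v X"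
      using a by (simp add: z glue_in_hook_maps)
    have "h1 \<in> extensional {x \<in> D. x < d}" "h2 \<in> extensional {x \<in> D. d < x}"
      using a descents_U[OF a(1)] descents_S[OF a(1)] by (auto simp: hook_maps_def PiE_def)
    hence "restrict (glue t h1 h2) {x \<in> D. x < d} = h1" "restrict (glue t h1 h2) {x \<in> D. d < x} = h2"
      by (auto simp: glue_def extensional_def fun_eq_iff)
    thus "(\<lambda>h. (h d, restrict h {x \<in> D. x < d}, restrict h {x \<in> D. d < x}))
        (case z of (t, h1, h2) \<Rightarrow> glue t h1 h2) = z"
      by (simp add: z) (simp add: glue_def)
  next
    fix h assume h: "h \<in> hook_maps v X"
    note s = split_hook_map[OF h]
    show "(case (h d, restrict h {x \<in> D. x < d}, restrict h {x \<in> D. d < x}) of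
        (t, h1, h2) \<Rightarrow> glue t h1 h2) = h" using s(4) by simp
    show "(h d, restrict h {x \<in> D. x < d}, restrict h {x \<in> D. d < x}) \<in> ?I" using s by auto
    show "(case (h d, restrict h {x \<in> D. x < d}, restrict h {x \<in> D. d < x}) of
        (t, h1, h2) \<Rightarrow> hook_weight v (U t) h1 * hook_weight v (S t) h2) = hook_weight v X h"
      using weight_glue[OF s(1-3)] s(4) by simp
  qed
  also have "\<dots> = (\<Sum>t\<in>T. \<Sum>(h1, h2)\<in>hook_maps v (U t) \<times> hook_maps v (S t). hook_weight v (U t) h1 * hook_weight v (S t) h2)"
    by (subst sum.Sigma) (auto simp: fin)
  finally show ?thesis by (simp only: sum_product sum.cartesian_product)
qed

text \<open>Balances the powers of \<open>fps_X\<close>: the single factor in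
  \<open>fertility_split\<close> accounts for \<open>d\<close>.\<close>

lemma card_descents_split: assumes "t \<in> T"
  shows "card D = Suc (card (word_descents v (U t)) + card (word_descents v (S t)))"
proof -
  have fin: "finite D" by (simp add: D_def)
  have "D = insert d ({x \<in> D. x < d} \<union> {x \<in> D. d < x})" using dD by auto
  hence "card D = card (insert d ({x \<in> D. x < d} \<union> {x \<in> D. d < x}))" by (rule arg_cong)
  also have "\<dots> = Suc (card ({x \<in> D. x < d} \<union> {x \<in> D. d < x}))" using fin by (intro card_insert_disjoint) auto
  also have "card ({x \<in> D. x < d} \<union> {x \<in> D. d < x}) = card {x \<in> D. x < d} + card {x \<in> D. d < x}"
    using fin by (intro card_Un_disjoint) auto
  finally show ?thesis by (simp add: descents_U[OF assms] descents_S[OF assms])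
qed

text \<open>Positions before \<open>d\<close> carry smaller entries, and behind \<open>d\<close> the
  small entries precede all of \<open>T\<close>. So the word reads \<open>A\<close>,
  \<open>d\<close>, \<open>B\<close>, \<open>T\<close>, the shape treated by
  \<open>fertility_decomposition\<close>.\<close>

lemma fertility_split:
  "fertility (word v X) = fps_X * (\<Sum>t\<in>T. fertility (word v (U t)) * fertility (word v (S t)))"
proof -
  let ?s = sorted_list_of_set
  define A B where "A = {p \<in> X. p < d}" and "B = {p \<in> X. d < p \<and> v p < v d}"
  note AB = A_def B_def
  have fin: "finite A" "finite B" "finite T" by (auto simp: AB T_def)
  have BT: "\<forall>p\<in>B. \<forall>t\<in>T. p < t"
  proof (intro ballI)
    fix p t assume "p \<in> B" "t \<in> T"
    thus "p < t" using tail_closed[of t p] by (cases "p < t") (auto simp: B_def T_def)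
  qed
  have order: "\<forall>p\<in>T. d < p" "\<forall>p\<in>A. \<forall>q\<in>T. p < q" "\<forall>p\<in>A. \<forall>q\<in>B. p < q" "\<forall>p\<in>A. p < d" "\<forall>p\<in>B. d < p"
    by (auto simp: AB dest: tail_after)
  have AX: "v p < v d" if "p \<in> A" for p
    using that tail_after[of p] inj_le[of p d] by (cases "v d < v p") (auto simp: A_def T_def)
  have sX: "?s X = ?s A @ d # ?s B @ ?s T"
  proof (rule sorted_list_of_set_eqI)
    show "sorted_wrt (<) (?s A @ d # ?s B @ ?s T)"
      using fin BT order by (simp add: sorted_wrt_append ball_Un)
    show "set (?s A @ d # ?s B @ ?s T) = X"
    proof -
      have "p \<in> A \<or> p = d \<or> p \<in> B \<or> p \<in> T" if "p \<in> X" for p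
        using that inj_le[of p d] by (cases p d rule: linorder_cases) (auto simp: AB T_def)
      hence "A \<union> {d} \<union> B \<union> T = X" using dX by (auto simp: AB T_def)
      thus ?thesis using fin by auto
    qed
  qed
  define ts where "ts = ?s T"
  have ts: "sorted_wrt (<) ts" "set ts = T" "distinct ts" using fin by (auto simp: ts_def)
  have tj: "?s (U (ts ! j)) = ?s A @ d # drop (Suc j) ts" "?s (S (ts ! j)) = ?s B @ take j ts"
    if j: "j < length ts" for j
  proof -
    let ?t = "ts ! j"
    have eq: "ts = take j ts @ ?t # drop (Suc j) ts" using j by (rule id_take_nth_drop)
    hence "sorted_wrt (<) (take j ts @ ?t # drop (Suc j) ts)" using ts by simp
    hence sw: "\<forall>x\<in>set (take j ts). x < ?t" "\<forall>x\<in>set (drop (Suc j) ts). ?t < x"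
      by (auto simp: sorted_wrt_append)
    have "T = set (take j ts @ ?t # drop (Suc j) ts)" using ts(2) eq by metis
    hence T: "T = set (take j ts) \<union> {?t} \<union> set (drop (Suc j) ts)" by auto
    have t: "?t \<in> T" using j ts by (metis nth_mem)
    have dr: "set (drop (Suc j) ts) = {x \<in> T. ?t < x}" using T sw by auto
    have tk: "set (take j ts) = {x \<in> T. x < ?t}" using T sw by auto
    show "?s (U ?t) = ?s A @ d # drop (Suc j) ts"
    proof (rule sorted_list_of_set_eqI)
      show "sorted_wrt (<) (?s A @ d # drop (Suc j) ts)"
        using fin ts order by (simp add: sorted_wrt_append dr sorted_wrt_drop)
      have "p \<in> X \<and> d < p" if "p \<in> T" for p using that tail_after by (simp add: T_def)
      hence "A \<union> {d} \<union> {x \<in> T. ?t < x} = U ?t"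
        using tail_closed[OF t] dX by (auto simp: A_def U_def)
      thus "set (?s A @ d # drop (Suc j) ts) = U ?t" using fin by (auto simp: dr)
    qed
    show "?s (S ?t) = ?s B @ take j ts"
    proof (rule sorted_list_of_set_eqI)
      show "sorted_wrt (<) (?s B @ take j ts)"
        using fin ts BT by (simp add: sorted_wrt_append tk sorted_wrt_take)
      have "p \<in> B \<or> p \<in> T" if "p \<in> X" "d < p" for p
        using that inj_le[of p d] by (auto simp: B_def T_def)
      moreover have "p \<in> X \<and> d < p" if "p \<in> T" for p using that tail_after by (simp add: T_def)
      moreover have "\<forall>p\<in>B. p < ?t" using BT t by blast
      ultimately have "B \<union> {x \<in> T. x < ?t} = S ?t" by (auto simp: B_def S_def)
      thus "set (?s B @ take j ts) = S ?t" using fin by (simp add: tk)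
    qed
  qed
  let ?a = "map v (?s A)" and ?b = "map v (?s B)" and ?c = "map v ts"
  have "fertility (word v X) = fertility (?a @ v d # ?b @ ?c)"
    by (simp add: word_def sX ts_def)
  also have "\<dots> = fps_X * (\<Sum>j<length ?c. fertility (?a @ v d # drop (Suc j) ?c) * fertility (?b @ take j ?c))"
  proof (rule fertility_decomposition)
    have "distinct (map v (?s X))" using inj by (simp add: distinct_map)
    thus "distinct (?a @ v d # ?b @ ?c)" by (simp add: sX ts_def)
    obtain j where "j \<in> B" using next_d by (auto simp: B_def)
    thus "?b \<noteq> []" using fin by auto
    show "\<forall>x\<in>set ?a \<union> set ?b. x < v d" using AX fin by (auto simp: B_def)
    show "\<forall>t\<in>set ?c. v d < t" using ts by (auto simp: T_def)
    have "sorted_wrt (\<lambda>x y. v x < v y) ts"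
      by (rule sorted_wrt_mono_rel[OF _ ts(1)]) (use ts tail_increasing in \<open>auto simp: T_def\<close>)
    hence "sorted_wrt (<) ?c" by (simp add: sorted_wrt_map)
    thus "sorted ?c" by (simp add: strict_sorted_iff)
  qed
  also have "\<dots> = fps_X * (\<Sum>j<length ts. fertility (word v (U (ts ! j))) * fertility (word v (S (ts ! j))))"
    by (simp add: word_def tj drop_map take_map)
  also have "(\<Sum>j<length ts. fertility (word v (U (ts ! j))) * fertility (word v (S (ts ! j)))) =
    (\<Sum>t\<in>T. fertility (word v (U t)) * fertility (word v (S t)))"
    using ts by (intro sum.reindex_bij_betw bij_betw_nth) auto
  finally show ?thesis .
qed

end

section \<open>Hook expansion of the fertility polynomial\<close>

theorem fertility_eq_sum_hook_weight:
  assumes "finite X" "X \<noteq> {}" "0 \<notin> X" "inj_on v X"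
  shows "fertility (word v X) = fps_X ^ card (word_descents v X) * (\<Sum>h\<in>hook_maps v X. hook_weight v X h)"
  using assms
proof (induction "card X" arbitrary: X rule: less_induct)
  case less
  note [simp] = less.prems(1)
  show ?case
  proof (cases "word_descents v X = {}")
    case True
    have "v p < v q" if "p \<in> X" "q \<in> X" "p < q" for p q
    proof -
      have "\<not> v q < v p" using ex_word_descent_between[of X p q v] that True by auto
      moreover have "v p \<noteq> v q" using that less.prems(4) by (metis inj_on_contraD less_irrefl)
      ultimately show ?thesis by simp
    qed
    hence "sorted_wrt (\<lambda>x y. v x < v y) (sorted_list_of_set X)"
      by (intro sorted_wrt_mono_rel[OF _ strict_sorted_list_of_set]) auto
    hence "sorted_wrt (<) (word v X)" by (simp add: word_def sorted_wrt_map)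
    moreover have "word v X \<noteq> []" using less.prems by (simp add: word_def)
    ultimately have "fertility (word v X) = narayana_series (card X)"
      by (simp add: fertility_sorted word_def)
    moreover have "hook_maps v X = {\<lambda>_. undefined}" by (simp add: hook_maps_def True)
    moreover have "hook_weight v X (\<lambda>_. undefined) = narayana_series (card X)"
      by (simp add: hook_weight_def True hook_color_def)
    ultimately show ?thesis by (simp add: True)
  next
    case False
    have "Max (v ` word_descents v X) \<in> v ` word_descents v X" using False by (intro Max_in) auto
    then obtain d where d: "d \<in> word_descents v X" "v d = Max (v ` word_descents v X)" by force
    hence max: "v d' \<le> v d" if "d' \<in> word_descents v X" for d' using that by simp
    interpret max_descent v X d by standard (use d(1) max less.prems in auto)
    let ?G = "\<lambda>X. \<Sum>h\<in>hook_maps v X. hook_weight v X h"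
    have IH: "fertility (word v Y) = fps_X ^ card (word_descents v Y) * ?G Y"
      if "Y \<subseteq> X" "card Y < card X" "Y \<noteq> {}" for Y
      using that less.prems by (intro less.hyps) (auto intro: finite_subset inj_on_subset)
    have "fertility (word v X) = fps_X * (\<Sum>t\<in>T. fertility (word v (U t)) * fertility (word v (S t)))"
      by (rule fertility_split)
    also have "\<dots> = fps_X * (\<Sum>t\<in>T. fps_X ^ (card D - 1) * (?G (U t) * ?G (S t)))"
    proof (intro arg_cong[of _ _ "\<lambda>y. fps_X * y"] sum.cong refl)
      fix t assume t: "t \<in> T"
      show "fertility (word v (U t)) * fertility (word v (S t)) = fps_X ^ (card D - 1) * (?G (U t) * ?G (S t))"
        using IH[OF sub(1) U_smaller[OF t] U_nonempty] IH[OF sub(2) S_smaller S_nonempty[OF t]]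
          card_descents_split[OF t] by (simp add: power_add mult_ac)
    qed
    also have "\<dots> = fps_X ^ Suc (card D - 1) * ?G X"
      by (simp add: sum_hook_weight sum_distrib_left mult.assoc)
    also have "Suc (card D - 1) = card D" using False by (simp add: D_def card_gt_0_iff)
    finally show ?thesis by (simp add: D_def)
  qed
qed

section \<open>Valid hook configurations as hook maps\<close>

lemma sorted_list_of_set_word: "sorted_list_of_set {1..n} = [1..<Suc n]"
  by (rule sorted_list_of_set_eqI) (auto simp del: upt_Suc)

text \<open>Passes from hooks addressed by an index from 1 to hooks as pairs in a set, where the
  conditions become free of indices.\<close>

lemma hooks_image: "set hs = (\<lambda>l. (sw hs l, ne hs l)) ` {1..length hs}"
proof -
  have "set hs = (\<lambda>l. hs ! (l - 1)) ` {1..length hs}"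
  proof (intro equalityI subsetI)
    fix z assume "z \<in> set hs"
    then obtain i where "i < length hs" "z = hs ! i" by (metis in_set_conv_nth)
    thus "z \<in> (\<lambda>l. hs ! (l - 1)) ` {1..length hs}" by (intro image_eqI[of _ _ "Suc i"]) auto
  qed auto
  thus ?thesis by (simp add: sw_def ne_def)
qed

lemma ex_hook: "(\<exists>l\<in>{1..length hs}. P (sw hs l) (ne hs l)) \<longleftrightarrow> (\<exists>i j. (i, j) \<in> set hs \<and> P i j)"
  by (subst hooks_image) blast

lemma all_hook: "(\<forall>l\<in>{1..length hs}. P (sw hs l) (ne hs l)) \<longleftrightarrow> (\<forall>i j. (i, j) \<in> set hs \<longrightarrow> P i j)"
  by (subst hooks_image) blast

lemma strict_mono_on_sw: "strict_mono_on {1..length hs} (sw hs) \<longleftrightarrow> sorted_wrt (<) (map fst hs)"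
proof -
  have "strict_mono_on {1..length hs} (sw hs) \<longleftrightarrow>
    (\<forall>j<length hs. \<forall>i<j. sw hs (Suc i) < sw hs (Suc j))"
  proof
    assume "strict_mono_on {1..length hs} (sw hs)"
    thus "\<forall>j<length hs. \<forall>i<j. sw hs (Suc i) < sw hs (Suc j)" by (auto simp: strict_mono_on_def)
  next
    assume *: "\<forall>j<length hs. \<forall>i<j. sw hs (Suc i) < sw hs (Suc j)"
    show "strict_mono_on {1..length hs} (sw hs)"
    proof (rule strict_mono_onI)
      fix r s assume "r \<in> {1..length hs}" "s \<in> {1..length hs}" "r < s"
      thus "sw hs r < sw hs s" using *[rule_format, of "s - 1" "r - 1"] by (cases r; cases s) auto
    qed
  qed
  thus ?thesis by (auto simp: sorted_wrt_iff_nth_less sw_def)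
qed

text \<open>Two common points exist exactly when the larger left end is below the smaller right end;
  for nondegenerate intervals only the two mixed comparisons remain.\<close>

lemma real_intervals_overlap:
  fixes a b c d :: nat
  assumes "a < b" "c < d"
  shows "(\<exists>x y. x \<noteq> y \<and> {x, y} \<subseteq> {real a..real b} \<inter> {real c..real d}) \<longleftrightarrow> a < d \<and> c < b"
proof
  assume "\<exists>x y. x \<noteq> y \<and> {x, y} \<subseteq> {real a..real b} \<inter> {real c..real d}"
  then obtain x y where xy: "x \<noteq> y" "real a \<le> x" "x \<le> real b" "real c \<le> x" "x \<le> real d"
    "real a \<le> y" "y \<le> real b" "real c \<le> y" "y \<le> real d" by auto
  hence "real a < real d" "real c < real b" by linarith+
  thus "a < d \<and> c < b" by simp
next
  assume "a < d \<and> c < b"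
  hence "max a c < min b d" using assms by auto
  hence "real (max a c) \<noteq> real (min b d) \<and> {real (max a c), real (min b d)} \<subseteq> {real a..real b} \<inter> {real c..real d}"
    by auto
  thus "\<exists>x y. x \<noteq> y \<and> {x, y} \<subseteq> {real a..real b} \<inter> {real c..real d}" by blast
qed

section \<open>Configurations of a fixed permutation\<close>

locale permutation_word =
  fixes n :: nat and \<pi> :: "nat list"
  assumes perm: "\<pi> \<in> permutations_of_set {1..n}"
begin

abbreviation "v \<equiv> entry \<pi>"
abbreviation "X \<equiv> {1..n}"
abbreviation "D \<equiv> descents \<pi>"

lemma distinct_perm: "distinct \<pi>" and set_perm: "set \<pi> = X"
  using permutations_of_setD[OF perm] by simp_all

lemma length_perm [simp]: "length \<pi> = n"
proof -
  have "length \<pi> = card X" using distinct_card[OF distinct_perm] unfolding set_perm by (rule sym)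
  thus ?thesis by simp
qed

lemma inj_entry: "inj_on v X"
proof (rule inj_onI)
  fix i j assume ij: "i \<in> X" "j \<in> X" "v i = v j"
  hence "i - 1 < n" "j - 1 < n" "1 \<le> i" "1 \<le> j" by auto
  moreover from this ij have "i - 1 = j - 1"
    using nth_eq_iff_index_eq[OF distinct_perm, of "i - 1" "j - 1"] by (simp add: entry_def)
  ultimately show "i = j" by simp
qed

lemma entry_neq: "i \<in> X \<Longrightarrow> j \<in> X \<Longrightarrow> i \<noteq> j \<Longrightarrow> v i \<noteq> v j"
  by (rule inj_on_contraD[OF inj_entry])

lemma word_perm: "word v X = \<pi>"
  unfolding word_def sorted_list_of_set_word by (rule nth_equalityI) (auto simp: entry_def simp del: upt_Suc)

lemma word_descents_perm: "word_descents v X = D"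
proof (intro equalityI subsetI)
  fix i assume "i \<in> word_descents v X"
  then obtain j where j: "i \<in> X" "j \<in> X" "i < j" "v j < v i" "\<forall>k\<in>X. \<not> (i < k \<and> k < j)"
    by (auto simp: word_descents_def)
  hence "j = Suc i" using j(5)[rule_format, of "Suc i"] by auto
  with j show "i \<in> D" by (auto simp: descents_def)
next
  fix i assume "i \<in> D"
  thus "i \<in> word_descents v X" unfolding word_descents_def
    by (auto simp: descents_def intro!: bexI[of _ "Suc i"])
qed

lemma hook_maps_iff: "h \<in> hook_maps v X \<longleftrightarrow> h \<in> D \<rightarrow>\<^sub>E X \<and> (\<forall>d\<in>D. d < h d \<and> v d < v (h d)) \<and>
    (\<forall>d\<in>D. \<forall>d'\<in>D. d < d' \<longrightarrow> h d \<le> d' \<or> h d' < h d)"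
  unfolding hook_maps_def word_descents_perm by simp

lemma hook_mapsD:
  assumes "h \<in> hook_maps v X"
  shows "d \<in> D \<Longrightarrow> h d \<in> X" "d \<in> D \<Longrightarrow> d < h d" "d \<in> D \<Longrightarrow> v d < v (h d)"
    "d \<in> D \<Longrightarrow> d' \<in> D \<Longrightarrow> d < d' \<Longrightarrow> h d \<le> d' \<or> h d' < h d" "h \<in> extensional D"
proof -
  note H = assms[unfolded hook_maps_iff]
  show "d \<in> D \<Longrightarrow> h d \<in> X" by (rule PiE_mem[OF conjunct1[OF H]])
  show "d \<in> D \<Longrightarrow> d < h d" "d \<in> D \<Longrightarrow> v d < v (h d)"
    "d \<in> D \<Longrightarrow> d' \<in> D \<Longrightarrow> d < d' \<Longrightarrow> h d \<le> d' \<or> h d' < h d"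
    using conjunct2[OF H] by blast+
  show "h \<in> extensional D" using conjunct1[OF H] by (simp only: PiE_def IntD2)
qed

lemma descent_iff: "i \<in> D \<longleftrightarrow> 1 \<le> i \<and> i < n \<and> v (Suc i) < v i"
  by (simp add: descents_def)

lemma valid_hook_configs_iff:
  "hs \<in> valid_hook_configs \<pi> \<longleftrightarrow> sorted_wrt (<) (map fst hs) \<and>
    (\<forall>i j. (i, j) \<in> set hs \<longrightarrow> 1 \<le> i \<and> i < j \<and> j \<le> n \<and> v i < v j) \<and>
    (\<forall>d\<in>D. \<exists>j. (d, j) \<in> set hs) \<and>
    (\<forall>i j. (i, j) \<in> set hs \<longrightarrow> (\<exists>d\<in>D. (d, j) \<in> set hs) \<and> (j - 1, j) \<in> set hs) \<and>
    (\<forall>i j. (i, j) \<in> set hs \<longrightarrow> (\<forall>i' j'. (i', j') \<in> set hs \<longrightarrow>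
       v j < v j' \<longrightarrow> i < j' \<longrightarrow> i' < j \<longrightarrow> i' \<le> i \<and> j \<le> j'))"
    (is "?l \<longleftrightarrow> ?sorted \<and> ?hooks \<and> ?desc \<and> ?ne \<and> ?cross")
proof -
  let ?L = "{1..length hs}"
  have 1: "(\<forall>h\<in>set hs. is_hook \<pi> h) \<longleftrightarrow> ?hooks" by (auto simp: is_hook_def)
  have 2: "(\<forall>i\<in>D. \<exists>l\<in>?L. sw hs l = i) \<longleftrightarrow> ?desc"
    using ex_hook[of hs "\<lambda>i j. i = _"] by simp
  have 3: "(\<forall>l\<in>?L. \<exists>l'\<in>?L. \<exists>l''\<in>?L. sw hs l' \<in> D \<and> sw hs l'' = ne hs l - 1 \<and>
      ne hs l' = ne hs l \<and> ne hs l'' = ne hs l) \<longleftrightarrow> ?ne"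
  proof -
    have "(\<exists>l'\<in>?L. \<exists>l''\<in>?L. sw hs l' \<in> D \<and> sw hs l'' = j - 1 \<and> ne hs l' = j \<and> ne hs l'' = j) \<longleftrightarrow>
      (\<exists>d\<in>D. (d, j) \<in> set hs) \<and> (j - 1, j) \<in> set hs" for j
      using ex_hook[of hs "\<lambda>i j'. i \<in> D \<and> j' = j"] ex_hook[of hs "\<lambda>i j'. i = j - 1 \<and> j' = j"] by auto
    thus ?thesis using all_hook[of hs "\<lambda>i j. (\<exists>d\<in>D. (d, j) \<in> set hs) \<and> (j - 1, j) \<in> set hs"] by simp
  qed
  \<comment> \<open>Conditional on \<open>?hooks\<close>, since the translation of overlapping
    intervals needs them to be nondegenerate.\<close>
  have 4: "(\<forall>l\<in>?L. \<forall>l'\<in>?L. v (ne hs l) < v (ne hs l') \<longrightarrow>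
        (\<exists>x y. x \<noteq> y \<and> {x, y} \<subseteq> hook_interval hs l \<inter> hook_interval hs l') \<longrightarrow>
        hook_interval hs l \<subseteq> hook_interval hs l') \<longleftrightarrow> ?cross" if H: ?hooks
  proof -
    define P where "P i j i' j' \<longleftrightarrow> (v j < v j' \<longrightarrow>
      (\<exists>x y. x \<noteq> y \<and> {x, y} \<subseteq> {real i..real j} \<inter> {real i'..real j'}) \<longrightarrow>
      {real i..real j} \<subseteq> {real i'..real j'})" for i j i' j'
    define Q where "Q i j i' j' \<longleftrightarrow> (v j < v j' \<longrightarrow> i < j' \<longrightarrow> i' < j \<longrightarrow> i' \<le> i \<and> j \<le> j')" for i j i' j'
    have "P i j i' j' \<longleftrightarrow> Q i j i' j'" if "(i, j) \<in> set hs" "(i', j') \<in> set hs" for i j i' j'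
    proof -
      have "i < j" "i' < j'" using H that by auto
      thus ?thesis unfolding P_def Q_def by (subst real_intervals_overlap) auto
    qed
    hence "(\<forall>i j. (i, j) \<in> set hs \<longrightarrow> (\<forall>i' j'. (i', j') \<in> set hs \<longrightarrow> P i j i' j')) \<longleftrightarrow>
      (\<forall>i j. (i, j) \<in> set hs \<longrightarrow> (\<forall>i' j'. (i', j') \<in> set hs \<longrightarrow> Q i j i' j'))"
      by blast
    thus ?thesis unfolding hook_interval_def all_hook[symmetric] P_def Q_def .
  qed
  have "?l \<longleftrightarrow> ?hooks \<and> ?sorted \<and> ?desc \<and> ?ne \<and>
    (\<forall>l\<in>?L. \<forall>l'\<in>?L. v (ne hs l) < v (ne hs l') \<longrightarrow>
        (\<exists>x y. x \<noteq> y \<and> {x, y} \<subseteq> hook_interval hs l \<inter> hook_interval hs l') \<longrightarrow>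
        hook_interval hs l \<subseteq> hook_interval hs l')"
    unfolding valid_hook_configs_def mem_Collect_eq 1 strict_mono_on_sw 2 3 ..
  thus ?thesis using 4 by blast
qed


text \<open>Laminarity alone keeps points from lying above a hook. A point \<open>p\<close> above
  the hook from \<open>d\<close> would yield a descent d' between \<open>p\<close> and
  \<open>h d\<close> with an entry at least \<open>v p\<close>; its hook ends before
  \<open>h d\<close> and higher still, against the induction hypothesis for the point
  \<open>h d'\<close>, which is closer to \<open>h d\<close>.\<close>

lemma below_hook:
  assumes h: "h \<in> hook_maps v X" and d: "d \<in> D" and p: "d < p" "p < h d"
  shows "v p < v (h d)"
  using p
proof (induction "h d - p" arbitrary: p rule: less_induct)
  case less
  have H: "h x \<in> X" "x < h x" "v x < v (h x)" if "x \<in> D" for x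
    using that by (rule hook_mapsD[OF h])+
  have pX: "p \<in> X" using less.prems H[OF d] d by (auto simp: descents_def)
  show ?case
  proof (rule ccontr)
    assume "\<not> v p < v (h d)"
    hence lt: "v (h d) < v p" using entry_neq[OF pX H(1)[OF d]] less.prems by simp
    obtain d' where d': "d' \<in> D" "p \<le> d'" "d' < h d" "v p \<le> v d'"
      using ex_word_descent_between[of X p "h d" v] pX H(1)[OF d] less.prems lt
      unfolding word_descents_perm by auto
    have "h d' < h d"
      using hook_mapsD(4)[OF h d d'(1)] d' less.prems by auto
    moreover have "v (h d') < v (h d)"
      using d' H[OF d'(1)] less.prems calculation by (intro less.hyps) auto
    ultimately show False using d' H[OF d'(1)] lt by linarith
  qed
qed

text \<open>Shows that the pair \<open>(h d - 1, h d)\<close> is a hook, and that it starts at a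
  position that is not a descent, so it never coincides with a hook from a descent.\<close>

lemma entry_pred_hook:
  assumes h: "h \<in> hook_maps v X" and d: "d \<in> D"
  shows "v (h d - 1) < v (h d)" "h d - 1 \<notin> D" "d < h d - 1"
proof -
  have H: "h d \<in> X" "d < h d" "v d < v (h d)" using hook_mapsD(1-3)[OF h d] by simp_all
  show *: "v (h d - 1) < v (h d)"
    using below_hook[OF h d, of "h d - 1"] H by (cases "d = h d - 1") auto
  have "Suc (h d - 1) = h d" using H by simp
  thus **: "h d - 1 \<notin> D" using * by (simp add: descent_iff)
  hence "d \<noteq> h d - 1" using d by metis
  thus "d < h d - 1" using H by linarith
qed

lemma inj_hook: assumes h: "h \<in> hook_maps v X" shows "inj_on h D"
proof (rule linorder_inj_onI)
  fix a b assume "a < b" "a \<in> D" "b \<in> D"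
  thus "h a \<noteq> h b" using hook_mapsD(4)[OF h, of a b] hook_mapsD(2)[OF h, of b] by auto
qed auto

text \<open>
  Condition (c) forces the companion hook from \<open>h d - 1\<close> to \<open>h d\<close>; together with the hook
  from \<open>d\<close> it accounts for the weight $2$ at \<open>h d\<close>.
\<close>

definition hook_list :: "(nat \<Rightarrow> nat) \<Rightarrow> (nat \<times> nat) list" where
  "hook_list h = map (\<lambda>i. (i, if i \<in> D then h i else Suc i)) (sorted_list_of_set (D \<union> (\<lambda>d. h d - 1) ` D))"

definition hook_map :: "(nat \<times> nat) list \<Rightarrow> nat \<Rightarrow> nat" where
  "hook_map hs = (\<lambda>d\<in>D. the (map_of hs d))"

lemma map_fst_hook_list: "map fst (hook_list h) = sorted_list_of_set (D \<union> (\<lambda>d. h d - 1) ` D)"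
  by (simp add: hook_list_def comp_def)

lemma set_hook_list:
  assumes h: "h \<in> hook_maps v X"
  shows "set (hook_list h) = (\<lambda>d. (d, h d)) ` D \<union> (\<lambda>d. (h d - 1, h d)) ` D"
proof -
  have "h d - 1 \<notin> D" "Suc (h d - 1) = h d" if "d \<in> D" for d
    using entry_pred_hook[OF h that] by auto
  thus ?thesis by (auto simp: hook_list_def image_Un image_image)
qed

lemma in_hook_list:
  assumes "h \<in> hook_maps v X"
  shows "(i, j) \<in> set (hook_list h) \<longleftrightarrow> (\<exists>d\<in>D. j = h d \<and> (i = d \<or> i = h d - 1))"
  unfolding set_hook_list[OF assms] by auto

lemma ne_count_conv:
  assumes "sorted_wrt (<) (map fst hs)"
  shows "ne_count hs j = card {i. (i, j) \<in> set hs}"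
proof -
  have sm: "strict_mono_on {1..length hs} (sw hs)" using assms by (simp only: strict_mono_on_sw)
  have "inj_on (sw hs) {1..length hs}" by (rule strict_mono_on_imp_inj_on[OF sm])
  hence "ne_count hs j = card (sw hs ` {l \<in> {1..length hs}. ne hs l = j})"
    unfolding ne_count_def by (rule card_image[OF inj_on_subset, symmetric]) auto
  also have "sw hs ` {l \<in> {1..length hs}. ne hs l = j} = {i. (i, j) \<in> set hs}"
    by (subst hooks_image) auto
  finally show ?thesis .
qed

lemma hook_list_valid:
  assumes h: "h \<in> hook_maps v X"
  shows "hook_list h \<in> valid_hook_configs_02 \<pi>"
proof -
  have H: "h x \<in> X" "x < h x" "v x < v (h x)" if "x \<in> D" for x
    using that by (rule hook_mapsD[OF h])+
  have D1: "1 \<le> d" if "d \<in> D" for d using that by (simp add: descent_iff)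
  have laminar: "h a \<le> b \<or> h b < h a" if "a \<in> D" "b \<in> D" "a < b" for a b
    using that by (rule hook_mapsD[OF h])+
  have sorted: "sorted_wrt (<) (map fst (hook_list h))" by (simp add: map_fst_hook_list)
  have cross: "i' \<le> i \<and> j \<le> j'"
    if ij: "(i, j) \<in> set (hook_list h)" "(i', j') \<in> set (hook_list h)"
      and lt: "v j < v j'" "i < j'" "i' < j" for i j i' j'
  proof -
    obtain a b where a: "a \<in> D" "j = h a" "i = a \<or> i = h a - 1" and b: "b \<in> D" "j' = h b" "i' = b \<or> i' = h b - 1"
      using ij by (auto simp: in_hook_list[OF h])
    \<comment> \<open>An end \<open>h b\<close> strictly between \<open>a\<close> and
      \<open>h a\<close> would lie below the hook from \<open>a\<close>, against
      \<open>v j < v j'\<close>.\<close>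
    have above: "\<not> (a < h b \<and> h b < h a)" using below_hook[OF h a(1), of "h b"] lt a b by auto
    have ne: "h a \<noteq> h b" using lt a b by auto
    have P: "a < h a - 1" "b < h b - 1" using entry_pred_hook(3)[OF h] a b by auto
    have "a < h b" using a(3) P lt(2) b(2) by auto
    hence lt': "h a < h b" using above ne by auto
    have "b < h a" using b(3) P lt(3) a(2) by auto
    have "b \<le> a" using laminar[of a b] a b lt' \<open>b < h a\<close> by (cases "a < b") auto
    \<comment> \<open>The companion start \<open>h b - 1\<close> is at least \<open>h a\<close>,
      hence too far right to overlap.\<close>
    have "i' = b" using b(3) lt(3) lt' a(2) by auto
    thus ?thesis using \<open>b \<le> a\<close> P a lt' b by auto
  qed
  have "1 \<le> i \<and> i < j \<and> j \<le> n \<and> v i < v j" if "(i, j) \<in> set (hook_list h)" for i j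
  proof -
    obtain d where d: "d \<in> D" "j = h d" "i = d \<or> i = h d - 1"
      using \<open>(i, j) \<in> _\<close> by (auto simp: in_hook_list[OF h])
    thus ?thesis using H[OF d(1)] D1[OF d(1)] entry_pred_hook[OF h d(1)] by auto
  qed
  moreover have "\<exists>j. (d, j) \<in> set (hook_list h)" if "d \<in> D" for d
    using that by (auto simp: in_hook_list[OF h])
  moreover have "(\<exists>d\<in>D. (d, j) \<in> set (hook_list h)) \<and> (j - 1, j) \<in> set (hook_list h)"
    if "(i, j) \<in> set (hook_list h)" for i j
    using that by (auto simp: in_hook_list[OF h])
  ultimately have valid: "hook_list h \<in> valid_hook_configs \<pi>"
    unfolding valid_hook_configs_iff using sorted cross by blast
  have "card {i. (i, j) \<in> set (hook_list h)} \<in> {0, 2}" for j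
  proof (cases "j \<in> h ` D")
    case True
    then obtain d where d: "d \<in> D" "j = h d" by auto
    hence "{i. (i, j) \<in> set (hook_list h)} = {d, h d - 1}"
      using inj_onD[OF inj_hook[OF h]] by (auto simp: in_hook_list[OF h])
    thus ?thesis using entry_pred_hook(3)[OF h d(1)] by auto
  next
    case False
    hence "{i. (i, j) \<in> set (hook_list h)} = {}" by (auto simp: in_hook_list[OF h])
    thus ?thesis by simp
  qed
  with valid show ?thesis by (simp add: valid_hook_configs_02_def ne_count_conv[OF sorted])
qed

lemma hook_map_hook_list:
  assumes h: "h \<in> hook_maps v X"
  shows "hook_map (hook_list h) = h"
proof -
  have "finite (D \<union> (\<lambda>d. h d - 1) ` D)" by simp
  hence "hook_map (hook_list h) = (\<lambda>d\<in>D. h d)"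
    by (auto simp: hook_map_def hook_list_def map_of_map_restrict restrict_def fun_eq_iff)
  also have "\<dots> = h" using hook_mapsD(5)[OF h] by (auto simp: extensional_def fun_eq_iff)
  finally show ?thesis .
qed

text \<open>By condition (c) every northeast endpoint j receives a hook from a descent and one from
  j - 1, which is not a descent; weight 2 leaves room for no other. So the hooks at descents
  determine the list.\<close>

lemma valid_hook_list:
  assumes hs: "hs \<in> valid_hook_configs_02 \<pi>"
  shows "hook_map hs \<in> hook_maps v X" "hook_list (hook_map hs) = hs"
proof -
  define h where "h = hook_map hs"
  have valid: "hs \<in> valid_hook_configs \<pi>" using hs by (simp add: valid_hook_configs_02_def)
  note V = valid[unfolded valid_hook_configs_iff]
  note sorted = V[THEN conjunct1] and hooks = V[THEN conjunct2, THEN conjunct1]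
    and desc = V[THEN conjunct2, THEN conjunct2, THEN conjunct1]
    and north = V[THEN conjunct2, THEN conjunct2, THEN conjunct2, THEN conjunct1]
    and cross = V[THEN conjunct2, THEN conjunct2, THEN conjunct2, THEN conjunct2, rule_format]
  have dist: "distinct (map fst hs)" using sorted by (simp add: strict_sorted_iff)
  have hk: "1 \<le> i" "i < j" "j \<le> n" "v i < v j" if "(i, j) \<in> set hs" for i j using hooks that by blast+
  have hD: "(d, h d) \<in> set hs" if d: "d \<in> D" for d
  proof -
    obtain j where "(d, j) \<in> set hs" using desc d by blast
    with dist d show ?thesis by (simp add: h_def hook_map_def)
  qed
  have fst_inj: "j = j'" if "(i, j) \<in> set hs" "(i, j') \<in> set hs" for i j j'
    using dist that by (metis eq_key_imp_eq_value)
  have cnt: "card {i. (i, j) \<in> set hs} = 2" if "(i, j) \<in> set hs" for i j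
  proof -
    have "j \<in> {1..length \<pi>}" using hk[OF that] by simp
    hence "card {i. (i, j) \<in> set hs} \<in> {0, 2}"
      using hs by (simp add: valid_hook_configs_02_def ne_count_conv[OF sorted])
    moreover have "finite {i. (i, j) \<in> set hs}"
      by (rule finite_subset[of _ "fst ` set hs"]) force+
    ultimately show ?thesis using that by auto
  qed
  have pred: "(j - 1, j) \<in> set hs" "j - 1 \<notin> D" if "(i, j) \<in> set hs" for i j
  proof -
    show *: "(j - 1, j) \<in> set hs" using north that by blast
    have "Suc (j - 1) = j" using hk[OF that] by simp
    thus "j - 1 \<notin> D" using hk(4)[OF *] by (simp add: descent_iff)
  qed
  have only: "i = d \<or> i = h d - 1" if "d \<in> D" "(i, h d) \<in> set hs" for d i
  proof (rule ccontr)
    assume *: "\<not> (i = d \<or> i = h d - 1)"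
    have "d \<noteq> h d - 1" using pred(2)[OF hD[OF that(1)]] that(1) by metis
    hence "card {i, d, h d - 1} = 3" using * by simp
    moreover have "{i, d, h d - 1} \<subseteq> {i. (i, h d) \<in> set hs}"
      using that hD[OF that(1)] pred(1)[OF hD[OF that(1)]] by auto
    moreover have "finite {i. (i, h d) \<in> set hs}"
      by (rule finite_subset[of _ "fst ` set hs"]) force+
    ultimately have "3 \<le> card {i. (i, h d) \<in> set hs}" by (metis card_mono)
    thus False using cnt[OF that(2)] by simp
  qed
  have mem: "(i, j) \<in> set hs \<longleftrightarrow> (\<exists>d\<in>D. j = h d \<and> (i = d \<or> i = h d - 1))" for i j
  proof
    assume ij: "(i, j) \<in> set hs"
    then obtain d where d: "d \<in> D" "(d, j) \<in> set hs" using north by blast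
    hence "j = h d" using fst_inj hD by blast
    with d only ij show "\<exists>d\<in>D. j = h d \<and> (i = d \<or> i = h d - 1)" by blast
  qed (use hD pred(1) in blast)
  have "h \<in> D \<rightarrow>\<^sub>E X" 
  proof (rule PiE_I)
    fix d assume "d \<in> D"
    from hk[OF hD[OF this]] show "h d \<in> X" by simp
  qed (simp add: h_def hook_map_def)
  moreover have "d < h d \<and> v d < v (h d)" if "d \<in> D" for d using hk[OF hD[OF that]] by simp
  \<comment> \<open>If the intervals crossed, condition (d), applied with the lower end first, would
    force a containment that the positions rule out. Equal ends would make d' the start of the
    companion hook, which is not a descent.\<close>
  moreover have "h d \<le> d' \<or> h d' < h d" if "d \<in> D" "d' \<in> D" "d < d'" for d d'
  proof (rule ccontr)
    assume *: "\<not> (h d \<le> d' \<or> h d' < h d)"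
    have X: "h d \<in> X" "h d' \<in> X" using hk(1-3)[OF hD[OF that(1)]] hk(1-3)[OF hD[OF that(2)]] by auto
    have "h d \<noteq> h d'"
    proof
      assume "h d = h d'"
      hence "d' = h d - 1" using only[OF that(1), of d'] hD[OF that(2)] that(3) by simp
      thus False using pred(2)[OF hD[OF that(1)]] that(2) by simp
    qed
    hence "v (h d) \<noteq> v (h d')" by (rule entry_neq[OF X])
    moreover have "\<not> v (h d) < v (h d')"
    proof
      assume "v (h d) < v (h d')"
      moreover have "d < h d'" using hk(2)[OF hD[OF that(2)]] that by simp
      moreover have "d' < h d" using * by simp
      ultimately have "d' \<le> d" using cross[OF hD[OF that(1)] hD[OF that(2)]] by simp
      thus False using that by simp
    qed
    ultimately have "v (h d') < v (h d)" by simp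
    moreover have "d < h d'" using hk(2)[OF hD[OF that(2)]] that by simp
    moreover have "d' < h d" using * by simp
    ultimately have "h d' \<le> h d" using cross[OF hD[OF that(2)] hD[OF that(1)]] by simp
    with * \<open>h d \<noteq> h d'\<close> show False by simp
  qed
  ultimately have h: "h \<in> hook_maps v X" unfolding hook_maps_iff by blast
  thus "hook_map hs \<in> hook_maps v X" by (simp only: h_def)
  have "set (hook_list h) = set hs" using mem in_hook_list[OF h] by auto
  moreover have "sorted_wrt (<) (map fst (hook_list h))" by (simp add: map_fst_hook_list)
  moreover have "inj_on fst (set hs)" using dist by (simp add: distinct_map)
  ultimately have "hook_list h = hs"
    using sorted by (intro map_sorted_distinct_set_unique[of fst]) (simp_all add: strict_sorted_iff)
  thus "hook_list (hook_map hs) = hs" by (simp only: h_def)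
qed

lemma bij_betw_hook_list: "bij_betw hook_list (hook_maps v X) (valid_hook_configs_02 \<pi>)"
  by (rule bij_betw_byWitness[of _ hook_map])
    (use hook_map_hook_list hook_list_valid valid_hook_list in auto)

end

section \<open>Colors\<close>

locale hook_configuration = permutation_word +
  fixes h :: "nat \<Rightarrow> nat"
  assumes h: "h \<in> hook_maps v X"
begin

abbreviation "hs \<equiv> hook_list h"
abbreviation "L \<equiv> {1..length hs}"

lemma sw_strict_mono: "strict_mono_on L (sw hs)"
  unfolding strict_mono_on_sw by (simp add: map_fst_hook_list)

lemma inj_sw: "inj_on (sw hs) L"
  by (rule strict_mono_on_imp_inj_on[OF sw_strict_mono])

lemma hook_at:
  assumes "l \<in> L"
  shows "(sw hs l \<in> D \<and> ne hs l = h (sw hs l)) \<or> (\<exists>d\<in>D. sw hs l = h d - 1 \<and> ne hs l = h d)"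
proof -
  have "(sw hs l, ne hs l) \<in> set hs" using assms by (subst hooks_image) (rule imageI)
  thus ?thesis unfolding in_hook_list[OF h] by auto
qed

lemma hook_index:
  assumes "d \<in> D"
  obtains l where "l \<in> L" "sw hs l = d" "ne hs l = h d"
proof -
  have "(d, h d) \<in> set hs" using assms by (auto simp: in_hook_list[OF h])
  hence "(d, h d) \<in> (\<lambda>l. (sw hs l, ne hs l)) ` L" by (simp only: hooks_image[symmetric])
  with that show thesis by auto
qed

lemma pred_hook_index:
  assumes "d \<in> D"
  obtains l where "l \<in> L" "sw hs l = h d - 1" "ne hs l = h d"
proof -
  have "(h d - 1, h d) \<in> set hs" using assms by (auto simp: in_hook_list[OF h])
  hence "(h d - 1, h d) \<in> (\<lambda>l. (sw hs l, ne hs l)) ` L" by (simp only: hooks_image[symmetric])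
  with that show thesis by auto
qed

lemma NE_eq: "NE hs = h ` D"
proof (intro equalityI subsetI)
  fix j assume "j \<in> NE hs"
  then obtain l where "l \<in> L" "j = ne hs l" by (auto simp: NE_def)
  thus "j \<in> h ` D" using hook_at[of l] by auto
next
  fix j assume "j \<in> h ` D"
  then obtain d where "d \<in> D" "j = h d" by auto
  thus "j \<in> NE hs" using hook_index[of d] by (metis NE_def imageI)
qed

text \<open>Southwest endpoints increase with the index, and among the hooks ending at
  \<open>h d\<close> the companion starts last.\<close>

lemma color_NE:
  assumes d: "d \<in> D" and l: "l \<in> L" "sw hs l = h d - 1" "ne hs l = h d"
  shows "color \<pi> hs (h d) = l"
proof -
  have "Max {r \<in> L. ne hs r = h d} = l"
  proof (rule Max_eqI)
    fix r assume "r \<in> {r \<in> L. ne hs r = h d}"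
    hence r: "r \<in> L" "ne hs r = h d" by auto
    have "sw hs r \<le> h d - 1"
      using hook_at[OF r(1)] r(2) entry_pred_hook(3)[OF h d] inj_onD[OF inj_hook[OF h]] d by fastforce
    hence "\<not> l < r" using strict_mono_onD[OF sw_strict_mono l(1) r(1)] l(2) by auto
    thus "r \<le> l" by simp
  qed (use l in auto)
  thus ?thesis using d by (simp add: color_def NE_eq)
qed

text \<open>Northeast endpoints use up precisely the colors of the companion hooks, by
  \<open>color_NE\<close>.\<close>

lemma Theta_eq: "Theta \<pi> hs = insert 0 {l \<in> L. sw hs l \<in> D}"
proof (intro equalityI subsetI)
  fix i assume i: "i \<in> Theta \<pi> hs"
  hence iL: "i \<le> length hs" "\<And>d. d \<in> D \<Longrightarrow> color \<pi> hs (h d) \<noteq> i" by (auto simp: Theta_def NE_eq)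
  show "i \<in> insert 0 {l \<in> L. sw hs l \<in> D}"
  proof (rule ccontr)
    assume *: "i \<notin> insert 0 {l \<in> L. sw hs l \<in> D}"
    hence "i \<in> L" "sw hs i \<notin> D" using iL(1) by auto
    then obtain d where d: "d \<in> D" "sw hs i = h d - 1" "ne hs i = h d" using hook_at by blast
    from color_NE[OF d(1) \<open>i \<in> L\<close> d(2-3)] iL(2)[OF d(1)] show False by simp
  qed
next
  fix i assume i: "i \<in> insert 0 {l \<in> L. sw hs l \<in> D}"
  have "color \<pi> hs (h d) \<noteq> i" if d: "d \<in> D" for d
  proof -
    obtain l where l: "l \<in> L" "sw hs l = h d - 1" "ne hs l = h d" using pred_hook_index[OF d] .
    have "l \<noteq> i" using i l entry_pred_hook(2)[OF h d] by auto
    thus ?thesis using color_NE[OF d l] by simp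
  qed
  thus "i \<in> Theta \<pi> hs" using i by (auto simp: Theta_def NE_eq)
qed

text \<open>Translates color indices into the names used by \<open>hook_color\<close>.\<close>

definition color_descent :: "nat \<Rightarrow> nat" where
  "color_descent l = (if l = 0 then 0 else sw hs l)"

lemma bij_betw_color_descent: "bij_betw color_descent (Theta \<pi> hs) (insert 0 D)"
proof -
  have D0: "0 \<notin> D" by (simp add: descents_def)
  have "inj_on color_descent (Theta \<pi> hs)"
  proof (rule inj_onI)
    fix a b assume ab: "a \<in> Theta \<pi> hs" "b \<in> Theta \<pi> hs" "color_descent a = color_descent b"
    have "x = 0 \<or> x \<in> L \<and> sw hs x \<in> D" if "x \<in> Theta \<pi> hs" for x
      using that unfolding Theta_eq by blast
    from this[OF ab(1)] this[OF ab(2)] ab(3) show "a = b"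
      using D0 inj_onD[OF inj_sw, of a b] by (cases "a = 0"; cases "b = 0") (auto simp: color_descent_def)
  qed
  moreover have "color_descent ` Theta \<pi> hs = insert 0 D"
  proof (intro equalityI subsetI)
    fix d assume "d \<in> insert 0 D"
    show "d \<in> color_descent ` Theta \<pi> hs"
    proof (cases "d = 0")
      case True
      thus ?thesis by (auto simp: Theta_eq color_descent_def)
    next
      case False
      hence d: "d \<in> D" using \<open>d \<in> insert 0 D\<close> by simp
      obtain l where "l \<in> L" "sw hs l = d" using hook_index[OF d] .
      thus ?thesis using d by (intro image_eqI[of _ _ l]) (auto simp: Theta_eq color_descent_def)
    qed
  qed (auto simp: Theta_eq color_descent_def)
  ultimately show ?thesis by (simp add: bij_betw_def)
qed

text \<open>The top part of a companion hook runs from \<open>h d - 1/2\<close> to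
  \<open>h d\<close>, so the only integer abscissa it meets is the northeast endpoint, which
  \<open>p\<close> avoids. For the hooks at descents, \<open>below_hook\<close> guarantees that they
  pass above \<open>p\<close>.\<close>

lemma hit_heights_eq:
  assumes p: "p \<in> X" "p \<notin> h ` D"
  shows "hit_heights \<pi> hs p = (\<lambda>d. real (v (h d))) ` {d \<in> D. d < p \<and> p < h d}"
proof (intro equalityI subsetI)
  fix y assume "y \<in> hit_heights \<pi> hs p"
  then obtain l where l: "l \<in> L" "real (sw hs l) + 1/2 \<le> real p" "real p \<le> real (ne hs l)" "y = real (v (ne hs l))"
    by (auto simp: hit_heights_def top_part_def)
  hence lt: "sw hs l < p" "p \<le> ne hs l" by linarith+
  from hook_at[OF l(1)] show "y \<in> (\<lambda>d. real (v (h d))) ` {d \<in> D. d < p \<and> p < h d}"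
  proof (elim disjE conjE bexE)
    assume "sw hs l \<in> D" "ne hs l = h (sw hs l)"
    moreover from this have "p \<noteq> ne hs l" using p by auto
    ultimately show ?thesis using lt l by auto
  next
    fix d assume d: "d \<in> D" "sw hs l = h d - 1" "ne hs l = h d"
    hence "p = h d" using lt by linarith
    thus ?thesis using d p by auto
  qed
next
  fix y assume "y \<in> (\<lambda>d. real (v (h d))) ` {d \<in> D. d < p \<and> p < h d}"
  then obtain d where d: "d \<in> D" "d < p" "p < h d" "y = real (v (h d))" by auto
  obtain l where l: "l \<in> L" "sw hs l = d" "ne hs l = h d" using hook_index[OF d(1)] .
  have "v p < v (h d)" by (rule below_hook[OF h d(1-3)])
  moreover have "real d + 1/2 \<le> real p" using d by linarith
  ultimately show "y \<in> hit_heights \<pi> hs p"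
    using d l by (auto simp: hit_heights_def top_part_def intro!: bexI[of _ l])
qed

text \<open>The hooks covering \<open>p\<close> are nested, and \<open>below_hook\<close> for an
  outer one puts the end of an inner one lower; so the minimal height belongs to the largest start.
  Distinct ends have distinct heights, and the maximum in \<open>color\<close> is taken over a
  single hook.\<close>

lemma color_point:
  assumes p: "p \<in> X" "p \<notin> h ` D"
  shows "color \<pi> hs p \<in> Theta \<pi> hs" "color_descent (color \<pi> hs p) = hook_color D h p"
proof -
  let ?C = "{d \<in> D. d < p \<and> p < h d}"
  have fin: "finite ?C" by simp
  have "color \<pi> hs p \<in> Theta \<pi> hs \<and> color_descent (color \<pi> hs p) = hook_color D h p"
  proof (cases "?C = {}")
    case True
    have "hit_heights \<pi> hs p = {}" unfolding hit_heights_eq[OF p] True by simp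
    hence "color \<pi> hs p = 0" using p by (simp add: color_def NE_eq)
    moreover have "hook_color D h p = 0" unfolding hook_color_def True by simp
    ultimately show ?thesis by (simp add: Theta_eq color_descent_def)
  next
    case False
    define d where "d = Max ?C"
    have "d \<in> ?C" unfolding d_def using fin False by (rule Max_in)
    hence d: "d \<in> D" "d < p" "p < h d" by auto
    have hc: "hook_color D h p = d" unfolding hook_color_def d_def using fin False by simp
    have hX: "h a \<in> X" if "a \<in> D" for a by (rule hook_mapsD(1)[OF h that])
    have "Min (hit_heights \<pi> hs p) = real (v (h d))"
    proof (rule Min_eqI)
      show "finite (hit_heights \<pi> hs p)" unfolding hit_heights_eq[OF p] by simp
      show "real (v (h d)) \<in> hit_heights \<pi> hs p" unfolding hit_heights_eq[OF p] using d by auto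
      fix y assume "y \<in> hit_heights \<pi> hs p"
      then obtain a where a: "a \<in> ?C" "y = real (v (h a))" unfolding hit_heights_eq[OF p] by auto
      have "a \<le> d" unfolding d_def using fin a by (intro Max_ge) auto
      show "real (v (h d)) \<le> y"
      proof (cases "a = d")
        case False
        hence "h d < h a" using hook_mapsD(4)[OF h, of a d] a d \<open>a \<le> d\<close> by auto
        moreover have "a < h d" using a d by auto
        ultimately have "v (h d) < v (h a)" using below_hook[OF h, of a "h d"] a by auto
        thus ?thesis using a by simp
      qed (use a in simp)
    qed
    moreover have "hit_heights \<pi> hs p \<noteq> {}" unfolding hit_heights_eq[OF p] using False by simp
    ultimately have col: "color \<pi> hs p =
        (ARG_MAX (sw hs) l. l \<in> L \<and> (real p, real (v (h d))) \<in> top_part \<pi> hs l)"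
      using p by (simp add: color_def NE_eq)
    obtain l where l: "l \<in> L" "sw hs l = d" "ne hs l = h d" using hook_index[OF d(1)] .
    have uniq: "r \<in> L \<and> (real p, real (v (h d))) \<in> top_part \<pi> hs r \<longleftrightarrow> r = l" for r
    proof
      assume r: "r \<in> L \<and> (real p, real (v (h d))) \<in> top_part \<pi> hs r"
      hence *: "real (sw hs r) + 1/2 \<le> real p" "v (ne hs r) = v (h d)" by (auto simp: top_part_def)
      have "ne hs r \<in> X" using r hook_at[of r] hX by auto
      hence ne: "ne hs r = h d" using *(2) inj_onD[OF inj_entry] hX[OF d(1)] by blast
      have lt: "sw hs r < p" using *(1) by linarith
      have "sw hs r = d"
        using hook_at[of r] r ne lt d inj_onD[OF inj_hook[OF h]] by fastforce
      thus "r = l" using r l inj_onD[OF inj_sw, of r l] by simp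
    next
      assume "r = l"
      moreover have "real d + 1/2 \<le> real p" using d by linarith
      ultimately show "r \<in> L \<and> (real p, real (v (h d))) \<in> top_part \<pi> hs r"
        using l d by (auto simp: top_part_def)
    qed
    have "color \<pi> hs p = l" unfolding col uniq by (rule arg_maxI[of _ l]) auto
    thus ?thesis using l d by (auto simp: hc Theta_eq color_descent_def)
  qed
  thus "color \<pi> hs p \<in> Theta \<pi> hs" "color_descent (color \<pi> hs p) = hook_color D h p" by auto
qed

text \<open>A northeast endpoint never has a color in \<open>Theta\<close>, and for the remaining
  points \<open>color_descent\<close> is injective on the colors that occur.\<close>

lemma color_count_eq:
  assumes l: "l \<in> Theta \<pi> hs"
  shows "color_count \<pi> hs l = card {p \<in> X - h ` D. hook_color D h p = color_descent l}"
proof -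
  have "color \<pi> hs p = l \<longleftrightarrow> p \<notin> h ` D \<and> hook_color D h p = color_descent l" if p: "p \<in> X" for p
  proof (cases "p \<in> h ` D")
    case True
    thus ?thesis using l by (auto simp: Theta_def NE_eq)
  next
    case False
    note c = color_point[OF p False]
    have "color \<pi> hs p = l \<longleftrightarrow> color_descent (color \<pi> hs p) = color_descent l"
      using inj_onD[OF bij_betw_imp_inj_on[OF bij_betw_color_descent]] c(1) l by blast
    thus ?thesis using False c(2) by simp
  qed
  hence "{p \<in> X. color \<pi> hs p = l} = {p \<in> X - h ` D. hook_color D h p = color_descent l}" by blast
  thus ?thesis by (simp only: color_count_def length_perm)
qed

lemma prod_reduced_color_count:
  assumes "k = card D"
  shows "(\<Prod>t = 0..k. narayana_series (reduced_color_count \<pi> hs t)) = hook_weight v X h"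
proof -
  let ?T = "Theta \<pi> hs"
  have fin: "finite ?T" by (simp add: Theta_eq)
  have "0 \<notin> D" by (simp add: descents_def)
  hence card: "card ?T = Suc k"
    using bij_betw_same_card[OF bij_betw_color_descent] assms by simp
  have bij: "bij_betw ((!) (sorted_list_of_set ?T)) {..<Suc k} ?T"
    using fin card by (intro bij_betw_nth) auto
  have "(\<Prod>t = 0..k. narayana_series (reduced_color_count \<pi> hs t)) =
    (\<Prod>t<Suc k. narayana_series (color_count \<pi> hs (sorted_list_of_set ?T ! t)))"
    by (simp only: reduced_color_count_def atMost_atLeast0 lessThan_Suc_atMost)
  also have "\<dots> = (\<Prod>l\<in>?T. narayana_series (color_count \<pi> hs l))"
    by (rule prod.reindex_bij_betw[OF bij])
  also have "\<dots> = (\<Prod>l\<in>?T. narayana_series (card {p \<in> X - h ` D. hook_color D h p = color_descent l}))"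
    by (intro prod.cong refl) (simp only: color_count_eq)
  also have "\<dots> = (\<Prod>c\<in>insert 0 D. narayana_series (card {p \<in> X - h ` D. hook_color D h p = c}))"
    by (rule prod.reindex_bij_betw[OF bij_betw_color_descent])
  finally show ?thesis by (simp only: hook_weight_def word_descents_perm)
qed

end

section \<open>Coefficient extraction in the descent variable\<close>

theorem theorem5p2:
  fixes n k m :: nat and \<pi> :: "nat list"
  assumes "n \<ge> 1"
    and "\<pi> \<in> permutations_of_set {1..n}"
    and "card (descents \<pi>) = k"
  shows "real (card {\<sigma> \<in> permutations_of_set {1..n}.
                       card (descents \<sigma>) = m \<and> stack_sort \<sigma> = \<pi>}) =
    (\<Sum>(hs, js) \<in> {(hs, js :: nat list).
        hs \<in> valid_hook_configs_02 \<pi> \<and> length js = k + 1 \<and> int (sum_list js) = int m - int k}.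
      \<Prod>t = 0..k. narayana (reduced_color_count \<pi> hs t) (js ! t + 1))"
proof -
  interpret permutation_word n \<pi> by standard (rule assms(2))
  let ?V = "valid_hook_configs_02 \<pi>" and ?H = "hook_maps v X"
  let ?N = "\<lambda>hs t. narayana_series (reduced_color_count \<pi> hs t)"
  have "{\<sigma> \<in> permutations_of_set X. card (descents \<sigma>) = m \<and> stack_sort \<sigma> = \<pi>} =
      {\<sigma> \<in> preimages \<pi>. m = card (descents \<sigma>)}"
    using preimagesD set_perm distinct_perm by (fastforce simp: permutations_of_set_def preimages_def)
  hence "real (card {\<sigma> \<in> permutations_of_set X. card (descents \<sigma>) = m \<and> stack_sort \<sigma> = \<pi>}) =
      (\<Sum>\<sigma>\<in>preimages \<pi>. if m = card (descents \<sigma>) then 1 else 0)"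
    by (simp add: sum.If_cases Int_def)
  also have "\<dots> = fps_nth (fertility \<pi>) m"
    by (simp add: fertility_def fps_sum_nth)
  also have "fertility \<pi> = fps_X ^ k * (\<Sum>h\<in>?H. hook_weight v X h)"
    by (rule fertility_eq_sum_hook_weight[of X v, unfolded word_perm word_descents_perm assms(3)])
      (use assms(1) inj_entry in auto)
  also have "(\<Sum>h\<in>?H. hook_weight v X h) = (\<Sum>h\<in>?H. \<Prod>t = 0..k. ?N (hook_list h) t)"
  proof (rule sum.cong[OF refl])
    fix h assume "h \<in> ?H"
    then interpret hook_configuration n \<pi> h by unfold_locales
    show "hook_weight v X h = (\<Prod>t = 0..k. ?N (hook_list h) t)"
      using prod_reduced_color_count assms(3) by simp
  qed
  also have "\<dots> = (\<Sum>hs\<in>?V. \<Prod>t = 0..k. ?N hs t)"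
    by (rule sum.reindex_bij_betw[OF bij_betw_hook_list])
  \<comment> \<open>\<open>natpermute\<close> lists the tuples of k + 1 natural numbers with sum m -
    k, which index the coefficient of a product of k + 1 series.\<close>
  also have "fps_nth (fps_X ^ k * (\<Sum>hs\<in>?V. \<Prod>t = 0..k. ?N hs t)) m =
    (if m < k then 0 else \<Sum>hs\<in>?V. \<Sum>js\<in>natpermute (m - k) (k + 1). \<Prod>t = 0..k. fps_nth (?N hs t) (js ! t))"
    by (simp only: fps_X_power_mult_nth fps_sum_nth fps_prod_nth)
  also have "\<dots> = (\<Sum>(hs, js) \<in> {(hs, js :: nat list).
        hs \<in> ?V \<and> length js = k + 1 \<and> int (sum_list js) = int m - int k}.
      \<Prod>t = 0..k. narayana (reduced_color_count \<pi> hs t) (js ! t + 1))"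
  proof (cases "m < k")
    case True
    \<comment> \<open>The required sum is a difference of integers, so it is negative here and no
      list attains it; truncated subtraction would give 0.\<close>
    hence "{(hs, js :: nat list). hs \<in> ?V \<and> length js = k + 1 \<and> int (sum_list js) = int m - int k} = {}"
      by auto
    with True show ?thesis by simp
  next
    case False
    have "{(hs, js :: nat list). hs \<in> ?V \<and> length js = k + 1 \<and> int (sum_list js) = int m - int k} =
      ?V \<times> natpermute (m - k) (k + 1)"
      using False by (auto simp: natpermute_def)
    with False show ?thesis
      by (simp add: sum.cartesian_product narayana_series_def del: natpermute_def)
  qed
  finally show ?thesis .
qed

end
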